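(* Let $\mathbf{G}$ be a connected semisimple Lie group with Lie algebra $\mathfrak{g}$, and let $(\mathfrak{g},\theta)$ be an orthogonal symmetric Lie algebra with symmetric pair $(\mathbf{G},\mathbf{K})$ and symmetric decomposition $\mathfrak{g}=\mathfrak{k}\oplus\mathfrak{m}$. Let $\Theta:\mathbf{G}\to\mathbf{G}$ be an involutive automorphism of $\mathbf{G}$ with differential $d\Theta=\theta$, such that $\Theta(K)=K$ for all $K\in\mathbf{K}$ and $\Theta(\exp m')=\exp(-m')$ for all $m'\in\mathfrak{m}$. Let $G\in\mathbf{G}$ be such that $G=K_0\exp(m)$ with $K_0\in\mathbf{K}$ and $m\in\mathfrak{m}$. Then $$\exp(2m)=\Theta(G^{-1})\,G .$$
   Context: Let $\mathfrak{g}$ be a real Lie algebra and $\theta$ an involutive automorphism of $\mathfrak{g}$ (i.e. $\theta\neq \mathrm{id}$, $\theta^2=\mathrm{id}$). The pair $(\mathfrak{g},\theta)$ is an orthogonal symmetric Lie algebra if the fixed-point set of $\theta$ is a compactly embedded subalgebra of $\mathfrak{g}$. Denote by $\mathfrak{k}$ and $\mathfrak{m}$ the $+1$ and $-1$ eigenspaces of $\theta$, so $\mathfrak{g}=\mathfrak{k}\oplus\mathfrak{m}$; this is the symmetric decomposition. If $\mathbf{G}$ is a connected Lie group with Lie algebra $\mathfrak{g}$ and $\mathbf{K}\subset\mathbf{G}$ is a Lie subgroup with Lie algebra $\mathfrak{k}$, then $(\mathbf{G},\mathbf{K})$ is called the symmetric pair of $(\mathfrak{g},\theta)$; $\mathbf{K}$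 is assumed closed and compact in $\mathbf{G}$. *)

theory Defs
  imports "HOL-Analysis.Analysis" "HOL-Algebra.Group"
begin

section \<open>Smooth maps between open subsets of normed spaces\<close>

text \<open>
  The domain is meant to be open, so that \<open>frechet_derivative f (at x)\<close> depends only on the
  values of the function there.  Over finite-dimensional spaces, being \<open>n + 1\<close> times continuously
  differentiable amounts to being differentiable with all directional derivatives \<open>n\<close> times
  continuously differentiable.
\<close>

fun Ck_on :: "nat \<Rightarrow> 'a::real_normed_vector set \<Rightarrow> ('a \<Rightarrow> 'b::real_normed_vector) \<Rightarrow> bool" where
  "Ck_on 0 S f \<longleftrightarrow> continuous_on S f"
| "Ck_on (Suc n) S f \<longleftrightarrow>
     (\<forall>x\<in>S. f differentiable (at x)) \<and>
     (\<forall>v. Ck_on n S (\<lambda>x. frechet_derivative f (at x) v))"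

definition smooth_on :: "'a::real_normed_vector set \<Rightarrow> ('a \<Rightarrow> 'b::real_normed_vector) \<Rightarrow> bool" where
  "smooth_on S f \<longleftrightarrow> (\<forall>n. Ck_on n S f)"


section \<open>Smooth manifolds\<close>

text \<open>
  A chart is a pair of its domain and its coordinate map; the values of the coordinate map outside
  the domain are irrelevant.  Atlases need not be maximal.
\<close>

type_synonym ('a, 'e) chart = "'a set \<times> ('a \<Rightarrow> 'e)"

definition smooth_manifold :: "'a topology \<Rightarrow> ('a, 'e::euclidean_space) chart set \<Rightarrow> bool" where
  "smooth_manifold T A \<longleftrightarrow>
     Hausdorff_space T \<and> second_countable T \<and>
     (\<Union>(U, \<phi>)\<in>A. U) = topspace T \<and>
     (\<forall>(U, \<phi>)\<in>A. openin T U \<and> open (\<phi> ` U) \<and>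
        homeomorphic_map (subtopology T U) (top_of_set (\<phi> ` U)) \<phi>) \<and>
     (\<forall>(U, \<phi>)\<in>A. \<forall>(V, \<psi>)\<in>A. smooth_on (\<phi> ` (U \<inter> V)) (\<psi> \<circ> inv_into U \<phi>))"

definition product_atlas ::
    "('a, 'e) chart set \<Rightarrow> ('b, 'f) chart set \<Rightarrow> ('a \<times> 'b, 'e \<times> 'f) chart set" where
  "product_atlas A B = {(U \<times> V, map_prod \<phi> \<psi>) |U \<phi> V \<psi>. (U, \<phi>) \<in> A \<and> (V, \<psi>) \<in> B}"

definition smooth_map ::
    "'a topology \<Rightarrow> ('a, 'e::euclidean_space) chart set \<Rightarrow>
     'b topology \<Rightarrow> ('b, 'f::euclidean_space) chart set \<Rightarrow> ('a \<Rightarrow> 'b) \<Rightarrow> bool" where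
  "smooth_map T A T' B f \<longleftrightarrow>
     continuous_map T T' f \<and>
     (\<forall>(U, \<phi>)\<in>A. \<forall>(V, \<psi>)\<in>B. smooth_on (\<phi> ` (U \<inter> f -` V)) (\<psi> \<circ> f \<circ> inv_into U \<phi>))"

definition smooth_near :: "'a topology \<Rightarrow> ('a, 'e::euclidean_space) chart set \<Rightarrow> 'a \<Rightarrow> ('a \<Rightarrow> real) set" where
  "smooth_near T A p =
     {f. \<exists>W. openin T W \<and> p \<in> W \<and> (\<forall>(U, \<phi>)\<in>A. smooth_on (\<phi> ` (U \<inter> W)) (f \<circ> inv_into U \<phi>))}"

text \<open>
  A tangent vector at \<open>p\<close> is the velocity at time \<open>0\<close> of a smooth curve through \<open>p\<close>, regarded as a
  directional derivative acting on the functions that are smooth near \<open>p\<close>.  As functions are total,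
  such an operator is normalised to be \<open>0\<close> on all other functions, so that equality of tangent
  vectors is equality of operators.
\<close>

definition velocity ::
    "'a topology \<Rightarrow> ('a, 'e::euclidean_space) chart set \<Rightarrow> (real \<Rightarrow> 'a) \<Rightarrow> ('a \<Rightarrow> real) \<Rightarrow> real" where
  "velocity T A c = (\<lambda>f. if f \<in> smooth_near T A (c 0) then deriv (f \<circ> c) 0 else 0)"

definition tangent_space ::
    "'a topology \<Rightarrow> ('a, 'e::euclidean_space) chart set \<Rightarrow> 'a \<Rightarrow> (('a \<Rightarrow> real) \<Rightarrow> real) set" where
  "tangent_space T A p =
     {velocity T A c |c \<epsilon>. \<epsilon> > 0 \<and> c 0 = p \<and>
        smooth_map (top_of_set {-\<epsilon><..<\<epsilon>}) {({-\<epsilon><..<\<epsilon>}, id)} T A c}"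

definition differential ::
    "'b topology \<Rightarrow> ('b, 'f::euclidean_space) chart set \<Rightarrow> ('a \<Rightarrow> 'b) \<Rightarrow> 'a \<Rightarrow>
     (('a \<Rightarrow> real) \<Rightarrow> real) \<Rightarrow> (('b \<Rightarrow> real) \<Rightarrow> real)" where
  "differential T' B F p D = (\<lambda>f. if f \<in> smooth_near T' B (F p) then D (f \<circ> F) else 0)"


section \<open>Lie groups and the exponential map\<close>

record ('a, 'e) smooth_group = "'a monoid" +
  lie_top :: "'a topology"
  lie_atlas :: "('a, 'e) chart set"

definition lie_group :: "('a, 'e::euclidean_space) smooth_group \<Rightarrow> bool" where
  "lie_group G \<longleftrightarrow>
     group G \<and> topspace (lie_top G) = carrier G \<and> smooth_manifold (lie_top G) (lie_atlas G) \<and>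
     smooth_map (prod_topology (lie_top G) (lie_top G)) (product_atlas (lie_atlas G) (lie_atlas G))
       (lie_top G) (lie_atlas G) (\<lambda>(x, y). x \<otimes>\<^bsub>G\<^esub> y) \<and>
     smooth_map (lie_top G) (lie_atlas G) (lie_top G) (lie_atlas G) (\<lambda>x. inv\<^bsub>G\<^esub> x)"

abbreviation smooth_at_one :: "('a, 'e::euclidean_space) smooth_group \<Rightarrow> ('a \<Rightarrow> real) set" where
  "smooth_at_one G \<equiv> smooth_near (lie_top G) (lie_atlas G) \<one>\<^bsub>G\<^esub>"

abbreviation tangent_at_one ::
    "('a, 'e::euclidean_space) smooth_group \<Rightarrow> (('a \<Rightarrow> real) \<Rightarrow> real) set" where
  "tangent_at_one G \<equiv> tangent_space (lie_top G) (lie_atlas G) \<one>\<^bsub>G\<^esub>"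

text \<open>
  The left-invariant vector field extending a tangent vector \<open>Y\<close> at the identity sends \<open>f\<close> to
  \<open>\<lambda>g. Y (\<lambda>h. f (g \<otimes>\<^bsub>G\<^esub> h))\<close>.  The bracket below is the value at the identity of the commutator of
  the two left-invariant vector fields.
\<close>

definition lie_bracket_at_one ::
    "('a, 'e::euclidean_space) smooth_group \<Rightarrow> (('a \<Rightarrow> real) \<Rightarrow> real) \<Rightarrow> (('a \<Rightarrow> real) \<Rightarrow> real) \<Rightarrow>
     (('a \<Rightarrow> real) \<Rightarrow> real)" where
  "lie_bracket_at_one G X Y =
     (\<lambda>f. if f \<in> smooth_at_one G
          then X (\<lambda>g. Y (\<lambda>h. f (g \<otimes>\<^bsub>G\<^esub> h))) - Y (\<lambda>g. X (\<lambda>h. f (g \<otimes>\<^bsub>G\<^esub> h)))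
          else 0)"

text \<open>
  One-parameter subgroups are continuous homomorphisms from the additive group of reals; these are
  automatically smooth.  There is exactly one with a given velocity at \<open>0\<close>.
\<close>

definition one_parameter_subgroup :: "('a, 'e::euclidean_space) smooth_group \<Rightarrow> (real \<Rightarrow> 'a) \<Rightarrow> bool" where
  "one_parameter_subgroup G \<gamma> \<longleftrightarrow>
     continuous_map euclideanreal (lie_top G) \<gamma> \<and> (\<forall>s t. \<gamma> (s + t) = \<gamma> s \<otimes>\<^bsub>G\<^esub> \<gamma> t)"

definition lie_exp :: "('a, 'e::euclidean_space) smooth_group \<Rightarrow> (('a \<Rightarrow> real) \<Rightarrow> real) \<Rightarrow> 'a" where
  "lie_exp G X =
     (THE g. \<exists>\<gamma>. one_parameter_subgroup G \<gamma> \<and>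
        (\<forall>f\<in>smooth_at_one G. ((f \<circ> \<gamma>) has_real_derivative X f) (at 0)) \<and> g = \<gamma> 1)"

text \<open>
  Lie subgroups are immersed: the topology of \<open>H\<close> may be finer than the one induced from \<open>G\<close>.
\<close>

definition lie_subgroup ::
    "('a, 'f::euclidean_space) smooth_group \<Rightarrow> ('a, 'e::euclidean_space) smooth_group \<Rightarrow> bool" where
  "lie_subgroup H G \<longleftrightarrow>
     lie_group H \<and> subgroup (carrier H) G \<and>
     (\<forall>x\<in>carrier H. \<forall>y\<in>carrier H. x \<otimes>\<^bsub>H\<^esub> y = x \<otimes>\<^bsub>G\<^esub> y) \<and>
     smooth_map (lie_top H) (lie_atlas H) (lie_top G) (lie_atlas G) id \<and>
     (\<forall>p\<in>carrier H. inj_on (differential (lie_top G) (lie_atlas G) id p)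
        (tangent_space (lie_top H) (lie_atlas H) p))"


section \<open>Real Lie algebras\<close>

text \<open>
  A finite-dimensional real Lie algebra is given by a bracket on a Euclidean space.  The inner
  product plays no role except that it provides the canonical topology and a basis for computing
  traces.
\<close>

definition lie_algebra :: "('l::euclidean_space \<Rightarrow> 'l \<Rightarrow> 'l) \<Rightarrow> bool" where
  "lie_algebra br \<longleftrightarrow>
     bilinear br \<and> (\<forall>x. br x x = 0) \<and>
     (\<forall>x y z. br x (br y z) + br y (br z x) + br z (br x y) = 0)"

definition lie_subalgebra :: "('l::euclidean_space \<Rightarrow> 'l \<Rightarrow> 'l) \<Rightarrow> 'l set \<Rightarrow> bool" where
  "lie_subalgebra br S \<longleftrightarrow> subspace S \<and> (\<forall>x\<in>S. \<forall>y\<in>S. br x y \<in> S)"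

definition linear_trace :: "('l::euclidean_space \<Rightarrow> 'l) \<Rightarrow> real" where
  "linear_trace f = (\<Sum>b\<in>Basis. f b \<bullet> b)"

definition killing_form :: "('l::euclidean_space \<Rightarrow> 'l \<Rightarrow> 'l) \<Rightarrow> 'l \<Rightarrow> 'l \<Rightarrow> real" where
  "killing_form br x y = linear_trace (br x \<circ> br y)"

definition semisimple :: "('l::euclidean_space \<Rightarrow> 'l \<Rightarrow> 'l) \<Rightarrow> bool" where
  "semisimple br \<longleftrightarrow> lie_algebra br \<and> (\<forall>x. (\<forall>y. killing_form br x y = 0) \<longrightarrow> x = 0)"

definition exp_ad :: "('l::euclidean_space \<Rightarrow> 'l \<Rightarrow> 'l) \<Rightarrow> 'l \<Rightarrow> 'l \<Rightarrow> 'l" where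
  "exp_ad br x = (\<lambda>y. \<Sum>n. (br x ^^ n) y /\<^sub>R fact n)"

text \<open>
  The analytic subgroup of the general linear group with Lie algebra \<open>ad S\<close> is generated, as a
  group, by the exponentials of \<open>ad S\<close>; the inverse of \<open>exp_ad br x\<close> is \<open>exp_ad br (- x)\<close>.
\<close>

inductive_set adjoint_subgroup :: "('l::euclidean_space \<Rightarrow> 'l \<Rightarrow> 'l) \<Rightarrow> 'l set \<Rightarrow> ('l \<Rightarrow> 'l) set"
  for br S where
  one: "id \<in> adjoint_subgroup br S"
| step: "x \<in> S \<Longrightarrow> f \<in> adjoint_subgroup br S \<Longrightarrow> exp_ad br x \<circ> f \<in> adjoint_subgroup br S"

text \<open>
  Compactness is that of the general linear group.  This agrees with compactness in the intrinsic
  Lie group topology of the analytic subgroup: a compact subgroup is closed, and a closed connected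
  Lie subgroup carries the induced topology.
\<close>

definition compactly_embedded :: "('l::euclidean_space \<Rightarrow> 'l \<Rightarrow> 'l) \<Rightarrow> 'l set \<Rightarrow> bool" where
  "compactly_embedded br S \<longleftrightarrow>
     lie_subalgebra br S \<and> compact (Blinfun ` adjoint_subgroup br S)"

definition involutive_lie_automorphism ::
    "('l::euclidean_space \<Rightarrow> 'l \<Rightarrow> 'l) \<Rightarrow> ('l \<Rightarrow> 'l) \<Rightarrow> bool" where
  "involutive_lie_automorphism br \<theta> \<longleftrightarrow>
     linear \<theta> \<and> (\<forall>x y. \<theta> (br x y) = br (\<theta> x) (\<theta> y)) \<and> \<theta> \<noteq> id \<and> \<theta> \<circ> \<theta> = id"

definition plus_eigenspace :: "('l::euclidean_space \<Rightarrow> 'l) \<Rightarrow> 'l set" where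
  "plus_eigenspace \<theta> = {x. \<theta> x = x}"

definition minus_eigenspace :: "('l::euclidean_space \<Rightarrow> 'l) \<Rightarrow> 'l set" where
  "minus_eigenspace \<theta> = {x. \<theta> x = - x}"

definition orthogonal_symmetric_lie_algebra ::
    "('l::euclidean_space \<Rightarrow> 'l \<Rightarrow> 'l) \<Rightarrow> ('l \<Rightarrow> 'l) \<Rightarrow> bool" where
  "orthogonal_symmetric_lie_algebra br \<theta> \<longleftrightarrow>
     lie_algebra br \<and> involutive_lie_automorphism br \<theta> \<and>
     compactly_embedded br (plus_eigenspace \<theta>)"


section \<open>Lie groups with a given Lie algebra\<close>

text \<open>
  The bijection \<open>\<iota>\<close> is the identification of the given Lie algebra with the tangent space of the
  group at the identity.
\<close>

definition has_lie_algebra ::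
    "('a, 'e::euclidean_space) smooth_group \<Rightarrow> ('l::euclidean_space \<Rightarrow> 'l \<Rightarrow> 'l) \<Rightarrow>
     ('l \<Rightarrow> ('a \<Rightarrow> real) \<Rightarrow> real) \<Rightarrow> bool" where
  "has_lie_algebra G br \<iota> \<longleftrightarrow>
     lie_group G \<and> lie_algebra br \<and> bij_betw \<iota> UNIV (tangent_at_one G) \<and>
     (\<forall>x y f. \<iota> (x + y) f = \<iota> x f + \<iota> y f) \<and>
     (\<forall>a x f. \<iota> (a *\<^sub>R x) f = a * \<iota> x f) \<and>
     (\<forall>x y. \<iota> (br x y) = lie_bracket_at_one G (\<iota> x) (\<iota> y))"

definition lie_subgroup_with_lie_algebra ::
    "('a, 'f::euclidean_space) smooth_group \<Rightarrow> ('a, 'e::euclidean_space) smooth_group \<Rightarrow>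
     ('l::euclidean_space \<Rightarrow> ('a \<Rightarrow> real) \<Rightarrow> real) \<Rightarrow> 'l set \<Rightarrow> bool" where
  "lie_subgroup_with_lie_algebra H G \<iota> S \<longleftrightarrow>
     lie_subgroup H G \<and>
     differential (lie_top G) (lie_atlas G) id \<one>\<^bsub>H\<^esub> ` tangent_at_one H = \<iota> ` S"

definition symmetric_pair ::
    "('a, 'e::euclidean_space) smooth_group \<Rightarrow> ('a, 'f::euclidean_space) smooth_group \<Rightarrow>
     ('l::euclidean_space \<Rightarrow> 'l \<Rightarrow> 'l) \<Rightarrow> ('l \<Rightarrow> 'l) \<Rightarrow> ('l \<Rightarrow> ('a \<Rightarrow> real) \<Rightarrow> real) \<Rightarrow> bool" where
  "symmetric_pair G K br \<theta> \<iota> \<longleftrightarrow>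
     has_lie_algebra G br \<iota> \<and> connected_space (lie_top G) \<and>
     lie_subgroup_with_lie_algebra K G \<iota> (plus_eigenspace \<theta>) \<and>
     closedin (lie_top G) (carrier K) \<and> compactin (lie_top G) (carrier K)"

definition involutive_lie_group_automorphism ::
    "('a, 'e::euclidean_space) smooth_group \<Rightarrow> ('a \<Rightarrow> 'a) \<Rightarrow> bool" where
  "involutive_lie_group_automorphism G \<Theta> \<longleftrightarrow>
     \<Theta> \<in> iso G G \<and> smooth_map (lie_top G) (lie_atlas G) (lie_top G) (lie_atlas G) \<Theta> \<and>
     (\<forall>x\<in>carrier G. \<Theta> (\<Theta> x) = x) \<and> (\<exists>x\<in>carrier G. \<Theta> x \<noteq> x)"

definition has_differential_at_one ::
    "('a, 'e::euclidean_space) smooth_group \<Rightarrow> ('l::euclidean_space \<Rightarrow> ('a \<Rightarrow> real) \<Rightarrow> real) \<Rightarrow>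
     ('a \<Rightarrow> 'a) \<Rightarrow> ('l \<Rightarrow> 'l) \<Rightarrow> bool" where
  "has_differential_at_one G \<iota> \<Theta> \<theta> \<longleftrightarrow>
     (\<forall>x. differential (lie_top G) (lie_atlas G) \<Theta> \<one>\<^bsub>G\<^esub> (\<iota> x) = \<iota> (\<theta> x))"

end

theory Submission
  imports Defs
begin

text \<open>
  Writing \<open>g = k\<^sub>0 exp m\<close>, we get \<open>\<Theta> (g\<inverse>) = (\<Theta> (exp m))\<inverse> k\<^sub>0\<inverse> = exp m k\<^sub>0\<inverse>\<close>, so that the claim
  becomes \<open>exp (2 m) = (exp m)\<^sup>2\<close>.  As \<open>exp\<close> is a definite description, its value is only known once
  there is exactly one one-parameter subgroup with a given velocity.  In a chart around the identity
  such a subgroup is an integral curve of a left-invariant vector field, which is locally Lipschitz.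
  Uniqueness follows from a Gronwall estimate.  For existence, the contraction principle gives a local
  integral curve; left invariance makes it a local homomorphism \<open>y\<close>, which extends to the whole line
  by \<open>t \<mapsto> y (t / n) ^ n\<close>.
\<close>

section \<open>Ordinary differential equations with Lipschitz right-hand side\<close>

text \<open>Picard iteration: the integral operator is a contraction on the bounded continuous
  functions on the line, and its fixed point solves the equation for short times.\<close>

lemma lipschitz_ode_global:
  fixes W :: "'e::euclidean_space \<Rightarrow> 'e"
  assumes W: "L-lipschitz_on UNIV W"
  obtains \<delta> x where "\<delta> > 0" "x 0 = x\<^sub>0"
    "\<And>t. \<bar>t\<bar> < \<delta> \<Longrightarrow> (x has_vector_derivative W (x t)) (at t)"
proof -
  have L: "L \<ge> 0" using W by (rule lipschitz_on_nonneg)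
  \<comment> \<open>The two integration ranges have total length at most
    \<open>3 * \<delta>\<close>, so the contraction constant is at most 1/2. The summand 6 covers
    the case \<open>L = 0\<close>.\<close>
  define \<delta> where "\<delta> = 1 / (6 * L + 6)"
  have \<delta>: "\<delta> > 0" and \<delta>L: "3 * \<delta> * L \<le> 1/2" using L by (auto simp: \<delta>_def field_simps)
  \<comment> \<open>Clamping time to the interval makes every iterate bounded and continuous on the
    whole line, so that the iteration takes place in a complete space.\<close>
  define c where "c t = max (-\<delta>) (min \<delta> t)" for t :: real
  have c: "c t \<in> {-\<delta>..\<delta>}" for t using \<delta> by (auto simp: c_def)
  have c_id: "c t = t" if "t \<in> {-\<delta>..\<delta>}" for t using that by (auto simp: c_def)
  have c_cont: "continuous_on UNIV c" unfolding c_def by (intro continuous_intros)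
  have W_cont: "continuous_on S W" for S
    using lipschitz_on_continuous_on[OF W] continuous_on_subset by blast
  text \<open>Integrating from \<open>-\<delta>\<close> and subtracting a constant handles both signs of \<open>t\<close> at once.\<close>
  define F where "F f t = x\<^sub>0 + integral {-\<delta>..c t} (\<lambda>s. W (f s)) - integral {-\<delta>..0} (\<lambda>s. W (f s))"
    for f :: "real \<Rightarrow>\<^sub>C 'e" and t
  have Wf_cont: "continuous_on S (\<lambda>s. W (apply_bcontfun f s))" for f :: "real \<Rightarrow>\<^sub>C 'e" and S
    using continuous_on_compose2[OF W_cont[of UNIV] continuous_on_apply_bcontfun[of S f]] by auto
  have int: "(\<lambda>s. W (apply_bcontfun f s)) integrable_on {a..b}" for f :: "real \<Rightarrow>\<^sub>C 'e" and a b
    by (intro integrable_continuous_real Wf_cont)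
  have I_cont: "continuous_on {-\<delta>..\<delta>} (\<lambda>u. integral {-\<delta>..u} (\<lambda>s. W (apply_bcontfun f s)))"
    for f :: "real \<Rightarrow>\<^sub>C 'e"
    by (intro indefinite_integral_continuous_1 int)
  have F_cont: "continuous_on UNIV (F f)" for f
    unfolding F_def by (intro continuous_intros continuous_on_compose2[OF I_cont c_cont]) (use c in auto)
  have F_c: "F f t = F f (c t)" for f t
    using c_id[OF c[of t]] by (simp add: F_def)
  have F_bc: "F f \<in> bcontfun" for f
  proof -
    have "range (F f) \<subseteq> F f ` {-\<delta>..\<delta>}"
      using F_c c by blast
    moreover have "compact (F f ` {-\<delta>..\<delta>})"
      by (intro compact_continuous_image continuous_on_subset[OF F_cont]) auto
    ultimately show ?thesis
      unfolding bcontfun_def using F_cont compact_imp_bounded bounded_subset by blast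
  qed
  define \<Phi> where "\<Phi> f = Bcontfun (F f)" for f
  have \<Phi>: "apply_bcontfun (\<Phi> f) = F f" for f
    using F_bc by (simp add: \<Phi>_def Bcontfun_inverse)
  have "dist (\<Phi> f) (\<Phi> h) \<le> 1/2 * dist f h" for f h
  proof (rule dist_bound)
    fix t
    have B: "norm (integral {-\<delta>..b} (\<lambda>s. W (f s) - W (h s))) \<le> L * dist f h * (b + \<delta>)"
      if "b \<ge> -\<delta>" for b
    proof -
      have "norm (W (f s) - W (h s)) \<le> L * dist f h" for s
        using lipschitz_onD[OF W, of "f s" "h s"] dist_bounded[of f s h] L
        by (smt (verit) UNIV_I dist_norm mult_left_mono)
      then show ?thesis
        using integral_bound[of "-\<delta>" b "\<lambda>s. W (f s) - W (h s)" "L * dist f h"] that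
          continuous_on_diff[OF Wf_cont Wf_cont] by (simp add: add.commute)
    qed
    have "F f t - F h t = integral {-\<delta>..c t} (\<lambda>s. W (f s) - W (h s))
        - integral {-\<delta>..0} (\<lambda>s. W (f s) - W (h s))"
      by (simp add: F_def integral_diff int)
    then have "dist (F f t) (F h t) \<le> L * dist f h * (c t + \<delta>) + L * dist f h * (0 + \<delta>)"
      using B[of "c t"] B[of 0] c[of t] \<delta>
      by (smt (verit) atLeastAtMost_iff dist_norm norm_triangle_ineq4)
    also have "\<dots> \<le> L * dist f h * (2 * \<delta>) + L * dist f h * \<delta>"
      using c[of t] L by (intro add_mono mult_left_mono) auto
    also have "\<dots> = (3 * \<delta> * L) * dist f h" by (simp add: algebra_simps)
    also have "\<dots> \<le> 1/2 * dist f h" using \<delta>L by (intro mult_right_mono) auto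
    finally show "dist (\<Phi> f t) (\<Phi> h t) \<le> 1/2 * dist f h" by (simp add: \<Phi>)
  qed
  then have "\<exists>!f. f \<in> UNIV \<and> \<Phi> f = f"
    by (intro Banach_fix[where c = "1/2"]) (auto simp: complete_UNIV)
  then obtain f where f: "\<Phi> f = f" by auto
  then have fF: "apply_bcontfun f t = F f t" for t using \<Phi> by metis
  show thesis
  proof
    show "\<delta> > 0" by fact
    show "f 0 = x\<^sub>0" using \<delta> by (subst fF) (simp add: F_def c_def)
    fix t :: real assume t: "\<bar>t\<bar> < \<delta>"
    have "((\<lambda>u. integral {-\<delta>..u} (\<lambda>s. W (f s))) has_vector_derivative W (f t)) (at t within {-\<delta>..\<delta>})"
      using t by (intro integral_has_vector_derivative Wf_cont) auto
    then have "((\<lambda>u. integral {-\<delta>..u} (\<lambda>s. W (f s))) has_vector_derivative W (f t)) (at t)"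
      using t by (simp add: at_within_Icc_at)
    then have D: "((\<lambda>u. x\<^sub>0 + integral {-\<delta>..u} (\<lambda>s. W (f s)) - integral {-\<delta>..0} (\<lambda>s. W (f s)))
        has_vector_derivative W (f t)) (at t)"
      by (auto intro!: derivative_eq_intros)
    \<comment> \<open>On the open interval the clamp is invisible, so there the fixed point
      coincides with the expression differentiated in \<open>D\<close>.\<close>
    have "x\<^sub>0 + integral {-\<delta>..u} (\<lambda>s. W (f s)) - integral {-\<delta>..0} (\<lambda>s. W (f s)) = f u"
      if "u \<in> {-\<delta><..<\<delta>}" for u
      using that c_id[of u] by (subst (3) fF) (simp add: F_def)
    moreover have "t \<in> {-\<delta><..<\<delta>}" using t by auto
    ultimately show "(f has_vector_derivative W (f t)) (at t)"
      using has_vector_derivative_transform_within_open[OF D open_greaterThanLessThan] by blast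
  qed
qed

text \<open>The nearest-point projection \<open>P\<close> onto the ball does not increase distances,
  so \<open>V\<close> composed with \<open>P\<close> is globally Lipschitz. By continuity its
  solution stays in the ball for a short time, where \<open>P\<close> is the identity.\<close>

lemma lipschitz_ode_local:
  fixes V :: "'e::euclidean_space \<Rightarrow> 'e"
  assumes V: "L-lipschitz_on (cball x\<^sub>0 r) V" and r: "r > 0"
  obtains \<delta> x where "\<delta> > 0" "x 0 = x\<^sub>0"
    "\<And>t. \<bar>t\<bar> < \<delta> \<Longrightarrow> x t \<in> ball x\<^sub>0 r"
    "\<And>t. \<bar>t\<bar> < \<delta> \<Longrightarrow> (x has_vector_derivative V (x t)) (at t)"
proof -
  define P where "P = closest_point (cball x\<^sub>0 r)"
  have ne: "cball x\<^sub>0 r \<noteq> {}" using r by auto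
  have P: "P x \<in> cball x\<^sub>0 r" for x
    unfolding P_def using closest_point_in_set[OF closed_cball ne] .
  have "L-lipschitz_on UNIV (\<lambda>x. V (P x))"
  proof (rule lipschitz_onI)
    show "0 \<le> L" using V by (rule lipschitz_on_nonneg)
    fix x y
    have "dist (V (P x)) (V (P y)) \<le> L * dist (P x) (P y)"
      by (intro lipschitz_onD[OF V] P)
    also have "\<dots> \<le> L * dist x y"
      unfolding P_def using \<open>0 \<le> L\<close> ne
      by (intro mult_left_mono closest_point_lipschitz) auto
    finally show "dist (V (P x)) (V (P y)) \<le> L * dist x y" .
  qed
  then obtain d x where d: "d > 0" and x0: "x 0 = x\<^sub>0"
    and x: "\<And>t. \<bar>t\<bar> < d \<Longrightarrow> (x has_vector_derivative V (P (x t))) (at t)"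
    by (rule lipschitz_ode_global[where x\<^sub>0 = x\<^sub>0]) blast
  have "isCont x 0" using x[of 0] d by (auto intro: has_vector_derivative_continuous)
  then obtain e where e: "e > 0" "\<And>t. \<bar>t\<bar> < e \<Longrightarrow> dist (x t) x\<^sub>0 < r"
    using r x0 unfolding continuous_at_eps_delta by (metis diff_zero dist_norm real_norm_def)
  show thesis
  proof
    show "min d e > 0" using d e by simp
    show "x 0 = x\<^sub>0" by fact
    fix t :: real assume t: "\<bar>t\<bar> < min d e"
    show b: "x t \<in> ball x\<^sub>0 r" using e(2)[of t] t by (simp add: dist_commute)
    then have "P (x t) = x t" by (simp add: P_def closest_point_self)
    then show "(x has_vector_derivative V (x t)) (at t)" using x[of t] t by simp
  qed
qed

text \<open>Gronwall's argument: a weighted squared distance between the solutions starts at 0,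
  cannot increase and is nonnegative.\<close>

lemma lipschitz_ode_unique_forward:
  fixes V :: "'e::euclidean_space \<Rightarrow> 'e"
  assumes V: "L-lipschitz_on B V"
    and x: "\<And>t. 0 \<le> t \<Longrightarrow> t < \<delta> \<Longrightarrow> x t \<in> B \<and> (x has_vector_derivative V (x t)) (at t)"
    and y: "\<And>t. 0 \<le> t \<Longrightarrow> t < \<delta> \<Longrightarrow> y t \<in> B \<and> (y has_vector_derivative V (y t)) (at t)"
    and xy: "x 0 = y 0" and t: "0 \<le> t" "t < \<delta>"
  shows "x t = y t"
proof -
  \<comment> \<open>The squared distance grows at rate at most \<open>2 * L\<close>, which the
    exponential weight cancels.\<close>
  define u where "u s = ((x s - y s) \<bullet> (x s - y s)) * exp (- 2 * L * s)" for s
  have "u t \<le> u 0"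
  proof (rule DERIV_nonpos_imp_nonincreasing[OF t(1)])
    fix s assume "0 \<le> s" "s \<le> t"
    then have s: "0 \<le> s" "s < \<delta>" using t by auto
    have d: "((\<lambda>s. x s - y s) has_vector_derivative (V (x s) - V (y s))) (at s)"
      using x[OF s] y[OF s] by (intro has_vector_derivative_diff) auto
    have q: "((\<lambda>s. (x s - y s) \<bullet> (x s - y s)) has_real_derivative
        2 * ((x s - y s) \<bullet> (V (x s) - V (y s)))) (at s)"
      using bounded_bilinear.has_vector_derivative[OF bounded_bilinear_inner d d]
      by (simp add: has_real_derivative_iff_has_vector_derivative inner_commute)
    have e: "((\<lambda>s. exp (- 2 * L * s)) has_real_derivative - 2 * L * exp (- 2 * L * s)) (at s)"
      by (auto intro!: derivative_eq_intros)
    have neg: "2 * a * E + - 2 * L * E * b \<le> 0" if "a \<le> L * b" "E > 0" for a b E :: real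
      using mult_right_mono[OF that(1), of E] that(2) by (simp add: mult_ac)
    have "(x s - y s) \<bullet> (V (x s) - V (y s)) \<le> L * ((x s - y s) \<bullet> (x s - y s))"
    proof -
      have "(x s - y s) \<bullet> (V (x s) - V (y s)) \<le> norm (x s - y s) * norm (V (x s) - V (y s))"
        by (rule norm_cauchy_schwarz)
      also have "\<dots> \<le> norm (x s - y s) * (L * norm (x s - y s))"
        using lipschitz_onD[OF V, of "x s" "y s"] x[OF s] y[OF s]
        by (intro mult_left_mono) (auto simp: dist_norm)
      finally show ?thesis by (simp add: dot_square_norm power2_eq_square algebra_simps)
    qed
    then show "\<exists>y. (u has_real_derivative y) (at s) \<and> y \<le> 0"
      unfolding u_def using DERIV_mult[OF q e] neg by (intro exI conjI) auto
  qed
  also have "u 0 = 0" using xy by (simp add: u_def)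
  finally have "(x t - y t) \<bullet> (x t - y t) \<le> 0"
    by (auto simp: u_def mult_le_0_iff dest: less_le_trans[OF exp_gt_zero])
  then show ?thesis by (metis eq_iff_diff_eq_0 inner_ge_zero inner_eq_zero_iff order_antisym)
qed

text \<open>Negative times reduce to the forward case by reversing time, which replaces
  \<open>V\<close> by its negative and keeps the constant \<open>L\<close>.\<close>

lemma lipschitz_ode_unique:
  fixes V :: "'e::euclidean_space \<Rightarrow> 'e"
  assumes V: "L-lipschitz_on B V"
    and x: "\<And>t. \<bar>t\<bar> < \<delta> \<Longrightarrow> x t \<in> B \<and> (x has_vector_derivative V (x t)) (at t)"
    and y: "\<And>t. \<bar>t\<bar> < \<delta> \<Longrightarrow> y t \<in> B \<and> (y has_vector_derivative V (y t)) (at t)"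
    and xy: "x 0 = y 0" and t: "\<bar>t\<bar> < \<delta>"
  shows "x t = y t"
proof (cases "t \<ge> 0")
  case True
  show ?thesis
    by (rule lipschitz_ode_unique_forward[OF V, of \<delta> x y]) (use x y xy t True in auto)
next
  case False
  have rev: "((\<lambda>s. z (- s)) has_vector_derivative - V (z (- s))) (at s)"
    if "(z has_vector_derivative V (z (- s))) (at (- s))" for z s
  proof -
    have "(uminus has_vector_derivative - 1) (at s)" by (auto intro!: derivative_eq_intros)
    from vector_diff_chain_at[OF this that] show ?thesis by (simp add: o_def)
  qed
  have "L-lipschitz_on B (\<lambda>z. - V z)" using V by (simp add: lipschitz_on_def dist_minus)
  then have "x (- (- t)) = y (- (- t))"
    by (rule lipschitz_ode_unique_forward[where x = "\<lambda>s. x (- s)" and y = "\<lambda>s. y (- s)" and \<delta> = \<delta>])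
      (use x y xy t False in \<open>auto intro!: rev\<close>)
  then show ?thesis by simp
qed

section \<open>Differentiability classes and charts\<close>

text \<open>On an open set the derivative at a point depends only on nearby values, so agreement
  passes to the directional derivatives and induction applies.\<close>

lemma Ck_on_cong:
  assumes "open S" "\<And>x. x \<in> S \<Longrightarrow> f x = g x" "Ck_on n S f"
  shows "Ck_on n S g"
  using assms(2,3)
proof (induction n arbitrary: f g)
  case 0
  then show ?case using continuous_on_cong[of S S f g] by simp
next
  case (Suc n)
  have D: "(g has_derivative D) (at x)" if "(f has_derivative D) (at x)" "x \<in> S" for x D
    by (rule has_derivative_transform_within_open[OF that(1) assms(1) that(2)]) (use Suc in auto)
  have "g differentiable (at x)" if "x \<in> S" for x
    using D[OF _ that] Suc.prems(2) that unfolding differentiable_def Ck_on.simps by blast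
  moreover have "frechet_derivative f (at x) = frechet_derivative g (at x)" if "x \<in> S" for x
    using D Suc.prems(2) that by (metis Ck_on.simps(2) frechet_derivative_at frechet_derivative_works)
  ultimately show ?case
    using Suc.prems Suc.IH[of "\<lambda>x. frechet_derivative f (at x) v" "\<lambda>x. frechet_derivative g (at x) v" for v]
    by auto
qed

text \<open>A bounded linear map commutes with differentiation, so each directional derivative again
  has the form covered by the induction.\<close>

lemma Ck_on_bounded_linear:
  assumes "open S" "bounded_linear h" "Ck_on n S f"
  shows "Ck_on n S (\<lambda>x. h (f x))"
  using assms(3)
proof (induction n arbitrary: f)
  case 0
  then show ?case using bounded_linear.continuous_on[OF assms(2)] by simp
next
  case (Suc n)
  have D: "((\<lambda>x. h (f x)) has_derivative (\<lambda>v. h (frechet_derivative f (at x) v))) (at x)" if "x \<in> S" for x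
    using Suc.prems that by (intro bounded_linear.has_derivative[OF assms(2)]) (simp add: frechet_derivative_works)
  have "Ck_on n S (\<lambda>x. frechet_derivative (\<lambda>x. h (f x)) (at x) v)" for v
  proof (rule Ck_on_cong[OF assms(1)])
    show "Ck_on n S (\<lambda>x. h (frechet_derivative f (at x) v))" using Suc by simp
    show "h (frechet_derivative f (at x) v) = frechet_derivative (\<lambda>x. h (f x)) (at x) v" if "x \<in> S" for x
      using frechet_derivative_at[OF D[OF that]] by metis
  qed
  then show ?case using D by (auto simp: differentiable_def)
qed

text \<open>The derivative is bounded on a compact ball, and balls are convex, so the mean value
  inequality applies.\<close>

lemma Ck_on_1_imp_lipschitz:
  fixes f :: "'a::euclidean_space \<Rightarrow> 'b::real_normed_vector"
  assumes f: "Ck_on (Suc 0) S f" and S: "open S" "z \<in> S"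
  obtains r L where "r > 0" "cball z r \<subseteq> S" "L-lipschitz_on (cball z r) f"
proof -
  obtain r where r: "r > 0" "cball z r \<subseteq> S" using S open_contains_cball by blast
  let ?f' = "\<lambda>x. frechet_derivative f (at x)"
  have D: "(f has_derivative ?f' x) (at x)" if "x \<in> S" for x
    using f that by (simp add: frechet_derivative_works)
  \<comment> \<open>\<open>Ck_on\<close> yields continuity of the derivative only for one direction
    at a time. The bounds for the basis directions are summed afterwards to bound the operator
    norm.\<close>
  have "\<exists>C. \<forall>x\<in>cball z r. norm (?f' x b) \<le> C" for b
  proof -
    have "continuous_on (cball z r) (\<lambda>x. ?f' x b)"
      by (rule continuous_on_subset[OF _ r(2)]) (use f in simp)
    then have "bounded ((\<lambda>x. ?f' x b) ` cball z r)"
      by (intro compact_imp_bounded compact_continuous_image) auto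
    then show ?thesis by (auto simp: bounded_iff)
  qed
  then obtain C where C: "\<And>b x. x \<in> cball z r \<Longrightarrow> norm (?f' x b) \<le> C b" by metis
  let ?L = "\<Sum>b\<in>Basis. C b"
  have L: "onorm (?f' x) \<le> ?L" if "x \<in> cball z r" for x
  proof -
    have "bounded_linear (?f' x)" using D r that has_derivative_bounded_linear by blast
    then have "onorm (?f' x) \<le> (\<Sum>b\<in>Basis. norm (?f' x b))" by (rule onorm_componentwise)
    also have "\<dots> \<le> ?L" using C that by (intro sum_mono) auto
    finally show ?thesis .
  qed
  have "?L-lipschitz_on (cball z r) f"
  proof (rule lipschitz_onI)
    show "dist (f x) (f y) \<le> ?L * dist x y" if "x \<in> cball z r" "y \<in> cball z r" for x y
      unfolding dist_norm
      by (rule differentiable_bound[OF convex_cball _ L that])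
        (use D r has_derivative_at_withinI in blast)
    have "norm (?f' z b) \<le> C b" for b using C[of z] r by auto
    then show "0 \<le> ?L" by (meson norm_ge_zero order_trans sum_nonneg)
  qed
  with r that show thesis by blast
qed

lemma has_vector_derivative_compose_has_derivative:
  assumes g: "(g has_vector_derivative v) (at t)" and F: "(F has_derivative F') (at (g t))"
  shows "((\<lambda>s. F (g s)) has_vector_derivative F' v) (at t)"
proof -
  have "((\<lambda>s. F (g s)) has_derivative (\<lambda>h. F' (h *\<^sub>R v))) (at t)"
    using has_derivative_compose[OF g[unfolded has_vector_derivative_def] F] .
  moreover have "F' (h *\<^sub>R v) = h *\<^sub>R F' v" for h
    by (rule linear_cmul[OF has_derivative_linear[OF F]])
  ultimately show ?thesis by (simp add: has_vector_derivative_def)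
qed

lemma smooth_manifold_chart:
  assumes "smooth_manifold T A" "(U, \<phi>) \<in> A"
  shows "openin T U" "open (\<phi> ` U)" "inj_on \<phi> U"
    "continuous_map (subtopology T U) euclidean \<phi>"
    "continuous_map (top_of_set (\<phi> ` U)) T (inv_into U \<phi>)"
proof -
  have U: "openin T U" "open (\<phi> ` U)" "homeomorphic_map (subtopology T U) (top_of_set (\<phi> ` U)) \<phi>"
    using assms unfolding smooth_manifold_def by fast+
  have top: "topspace (subtopology T U) = U" using openin_subset[OF U(1)] by auto
  show "openin T U" "open (\<phi> ` U)" by fact+
  show inj: "inj_on \<phi> U" using homeomorphic_imp_injective_map[OF U(3)] top by simp
  show "continuous_map (subtopology T U) euclidean \<phi>"
    using homeomorphic_imp_continuous_map[OF U(3)] by (simp add: continuous_map_in_subtopology)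
  \<comment> \<open>Any inverse \<open>h\<close> agrees with \<open>inv_into U \<phi>\<close> on the
    image of the chart, so its continuity carries over.\<close>
  obtain h where h: "homeomorphic_maps (subtopology T U) (top_of_set (\<phi> ` U)) \<phi> h"
    using U(3) by (auto simp: homeomorphic_map_maps)
  then have cont: "continuous_map (top_of_set (\<phi> ` U)) T h" and h: "\<And>u. u \<in> U \<Longrightarrow> h (\<phi> u) = u"
    using top by (auto simp: homeomorphic_maps_def continuous_map_in_subtopology)
  show "continuous_map (top_of_set (\<phi> ` U)) T (inv_into U \<phi>)"
    by (rule continuous_map_eq[OF cont]) (use h inj in auto)
qed

text \<open>The image is the preimage of \<open>W\<close> under the continuous inverse chart, whose
  domain is open.\<close>

lemma smooth_manifold_open_image:
  assumes "smooth_manifold T A" "(U, \<phi>) \<in> A" "openin T W"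
  shows "open (\<phi> ` (U \<inter> W))"
proof -
  note c = smooth_manifold_chart[OF assms(1,2)]
  have "\<phi> ` (U \<inter> W) = {x \<in> topspace (top_of_set (\<phi> ` U)). inv_into U \<phi> x \<in> W}"
    using c(3) by auto
  then show ?thesis
    using openin_continuous_map_preimage[OF c(5) assms(3)] c(2) openin_open_eq by (metis (no_types))
qed

text \<open>In another chart a coordinate function is a component of a transition map. These
  functions serve as test functions for reading off velocities.\<close>

lemma smooth_near_coordinate:
  assumes "smooth_manifold T A" "(U, \<phi>) \<in> A" "p \<in> U"
  shows "(\<lambda>q. \<phi> q \<bullet> b) \<in> smooth_near T A p"
proof -
  have U: "openin T U" using smooth_manifold_chart[OF assms(1,2)] by blast
  have "smooth_on (\<psi> ` (V \<inter> U)) ((\<lambda>q. \<phi> q \<bullet> b) \<circ> inv_into V \<psi>)" if V: "(V, \<psi>) \<in> A" for V \<psi>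
  proof -
    have "smooth_on (\<psi> ` (V \<inter> U)) (\<phi> \<circ> inv_into V \<psi>)"
      using assms(1,2) V unfolding smooth_manifold_def by fast
    then show ?thesis
      using Ck_on_bounded_linear[OF smooth_manifold_open_image[OF assms(1) V U] bounded_linear_inner_left[of b]]
      by (simp add: smooth_on_def o_def)
  qed
  then show ?thesis unfolding smooth_near_def using U assms(3) by blast
qed

lemma smooth_on_differentiable: "smooth_on S f \<Longrightarrow> x \<in> S \<Longrightarrow> f differentiable (at x)"
  using Ck_on.simps(2) unfolding smooth_on_def by blast

section \<open>Local homomorphisms from the reals\<close>

text \<open>An idempotent in a group is the identity. Additivity is assumed at 0 only, so that local
  and global homomorphisms are both covered.\<close>

lemma (in group) additive_hom_zero:
  fixes y :: "real \<Rightarrow> 'a"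
  assumes "y 0 \<in> carrier G" "y (0 + 0) = y 0 \<otimes> y 0"
  shows "y 0 = \<one>"
  using assms l_cancel_one[of "y 0" "y 0"] by simp

text \<open>Induction on \<open>k\<close>: the smaller multiples of \<open>u\<close> are no larger
  in absolute value, so they stay within the range of additivity.\<close>

lemma (in group) local_hom_nat_pow:
  fixes y :: "real \<Rightarrow> 'a"
  assumes carrier: "\<And>t. \<bar>t\<bar> < \<delta> \<Longrightarrow> y t \<in> carrier G"
    and hom: "\<And>s t. \<bar>s\<bar> < \<delta> \<Longrightarrow> \<bar>t\<bar> < \<delta> \<Longrightarrow> \<bar>s + t\<bar> < \<delta> \<Longrightarrow> y (s + t) = y s \<otimes> y t"
    and k: "\<bar>real k * u\<bar> < \<delta>"
  shows "y (real k * u) = y u [^] k"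
  using k
proof (induction k)
  case 0
  then show ?case using additive_hom_zero[of y] carrier[of 0] hom[of 0 0] by simp
next
  case (Suc k)
  have "real (Suc k) * \<bar>u\<bar> < \<delta>" using Suc.prems by (simp add: abs_mult)
  moreover have "real (Suc k) * \<bar>u\<bar> = real k * \<bar>u\<bar> + \<bar>u\<bar>" "0 \<le> real k * \<bar>u\<bar>"
    by (simp_all add: algebra_simps)
  ultimately have k: "\<bar>real k * u\<bar> < \<delta>" and u: "\<bar>u\<bar> < \<delta>" unfolding abs_mult by linarith+
  have eq: "real (Suc k) * u = real k * u + u" by (simp add: algebra_simps)
  show ?case using hom[OF k u] Suc.IH[OF k] Suc.prems unfolding eq by simp
qed

text \<open>The extension at \<open>t\<close> is \<open>y (t / n) ^ n\<close> for any
  \<open>n\<close> large enough to bring \<open>t / n\<close> into the domain.\<close>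

lemma (in group) local_hom_extends:
  fixes y :: "real \<Rightarrow> 'a"
  assumes \<delta>: "\<delta> > 0" and carrier: "\<And>t. \<bar>t\<bar> < \<delta> \<Longrightarrow> y t \<in> carrier G"
    and hom: "\<And>s t. \<bar>s\<bar> < \<delta> \<Longrightarrow> \<bar>t\<bar> < \<delta> \<Longrightarrow> \<bar>s + t\<bar> < \<delta> \<Longrightarrow> y (s + t) = y s \<otimes> y t"
  obtains \<gamma> where "\<And>t. \<gamma> t \<in> carrier G" "\<And>s t. \<gamma> (s + t) = \<gamma> s \<otimes> \<gamma> t"
    "\<And>t. \<bar>t\<bar> < \<delta> \<Longrightarrow> \<gamma> t = y t"
proof -
  have pow: "y (real k * u) = y u [^] k" if "\<bar>real k * u\<bar> < \<delta>" for k u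
    using local_hom_nat_pow[OF carrier hom that] .
  \<comment> \<open>Both powers equal the power with exponent \<open>n * m\<close> of
    \<open>y\<close> at the common refinement \<open>t / (n * m)\<close>.\<close>
  have indep: "y (t / real n) [^] n = y (t / real m) [^] m"
    if "n > 0" "m > 0" "\<bar>t / real n\<bar> < \<delta>" "\<bar>t / real m\<bar> < \<delta>" for t n m
  proof -
    define u where "u = t / (real n * real m)"
    have n: "t / real n = real m * u" and m: "t / real m = real n * u"
      using that by (auto simp: u_def)
    have "\<bar>u\<bar> \<le> \<bar>t / real n\<bar>" using that by (simp add: u_def abs_mult divide_simps mult_le_cancel_left1)
    then have "y u \<in> carrier G" using that carrier by auto
    then show ?thesis
      using that pow[of m u] pow[of n u] unfolding n m by (simp add: nat_pow_pow mult.commute)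
  qed
  have ex: "\<exists>n>0. \<bar>t / real n\<bar> < d" if "d > 0" for t d
  proof -
    obtain n where "real n > \<bar>t\<bar> / d" using reals_Archimedean2 by blast
    moreover from this have "n > 0" using that by (cases n) (auto simp: divide_less_0_iff)
    ultimately show ?thesis using that by (auto simp: field_simps)
  qed
  then obtain n where n: "\<And>t. n t > 0" "\<And>t. \<bar>t / real (n t)\<bar> < \<delta>" using \<delta> by metis
  define \<gamma> where "\<gamma> t = y (t / real (n t)) [^] n t" for t
  have \<gamma>: "\<gamma> t = y (t / real k) [^] k" if "k > 0" "\<bar>t / real k\<bar> < \<delta>" for k t
    unfolding \<gamma>_def using indep n that by blast
  show thesis
  proof
    show "\<gamma> t \<in> carrier G" for t unfolding \<gamma>_def using carrier n by simp
    show "\<gamma> t = y t" if "\<bar>t\<bar> < \<delta>" for t using \<gamma>[of 1 t] carrier that by simp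
    fix s t
    \<comment> \<open>A bound on the sum of the absolute values provides one \<open>k\<close> that
      serves \<open>s\<close>, \<open>t\<close> and \<open>s + t\<close> simultaneously.\<close>
    obtain k where k: "k > 0" "\<bar>(\<bar>s\<bar> + \<bar>t\<bar>) / real k\<bar> < \<delta>" using ex[OF \<delta>] by blast
    have *: "\<bar>s / real k\<bar> < \<delta>" "\<bar>t / real k\<bar> < \<delta>" "\<bar>s / real k + t / real k\<bar> < \<delta>"
      using k by (simp_all add: field_simps flip: add_divide_distrib)
    \<comment> \<open>Addition of reals is commutative, hence these two elements commute and the
      power of their product splits.\<close>
    have "y (s / real k) \<otimes> y (t / real k) = y (t / real k) \<otimes> y (s / real k)"
      using hom[OF *(1,2)] hom[OF *(2,1)] * by (simp add: add.commute)
    then have "(y (s / real k) \<otimes> y (t / real k)) [^] k = y (s / real k) [^] k \<otimes> y (t / real k) [^] k"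
      using carrier * by (intro pow_mult_distrib) auto
    then show "\<gamma> (s + t) = \<gamma> s \<otimes> \<gamma> t"
      using \<gamma>[of k s] \<gamma>[of k t] \<gamma>[of k "s + t"] k * hom[OF *] by (simp add: add_divide_distrib)
  qed
qed

section \<open>One-parameter subgroups and the exponential map\<close>

text \<open>Fixing one chart around the identity moves the analysis into the Euclidean space
  \<open>'e\<close>.\<close>

locale lie_group_chart = group G for G :: "('a, 'e::euclidean_space) smooth_group" (structure) +
  fixes U :: "'a set" and \<phi> :: "'a \<Rightarrow> 'e"
  assumes lie_group: "lie_group G" and chart: "(U, \<phi>) \<in> lie_atlas G" and one_U: "\<one> \<in> U"
begin

definition param :: "'e \<Rightarrow> 'a" where "param = inv_into U \<phi>"

text \<open>The group law in coordinates, taken on pairs to match the charts of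
  \<open>product_atlas\<close>. Its values matter only on \<open>coord_mult_dom\<close>.\<close>

definition coord_mult :: "'e \<times> 'e \<Rightarrow> 'e" where
  "coord_mult z = \<phi> (param (fst z) \<otimes> param (snd z))"

definition coord_mult_dom :: "('e \<times> 'e) set" where
  "coord_mult_dom = {z \<in> \<phi> ` U \<times> \<phi> ` U. param (fst z) \<otimes> param (snd z) \<in> U}"

text \<open>The left-invariant vector field with value \<open>w\<close> at the identity, in coordinates.\<close>

definition left_field :: "'e \<Rightarrow> 'e \<Rightarrow> 'e" where
  "left_field w x = frechet_derivative coord_mult (at (x, \<phi> \<one>)) (0, w)"

lemma topspace: "topspace (lie_top G) = carrier G"
  and manifold: "smooth_manifold (lie_top G) (lie_atlas G)"
  and mult_smooth: "smooth_map (prod_topology (lie_top G) (lie_top G))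
    (product_atlas (lie_atlas G) (lie_atlas G)) (lie_top G) (lie_atlas G) (\<lambda>(x, y). x \<otimes> y)"
  using lie_group by (auto simp: lie_group_def)

lemmas chart_facts = smooth_manifold_chart[OF manifold chart]

lemma U_carrier: "u \<in> U \<Longrightarrow> u \<in> carrier G"
  using openin_subset[OF chart_facts(1)] topspace by auto

lemma param_coord [simp]: "u \<in> U \<Longrightarrow> param (\<phi> u) = u"
  by (simp add: param_def chart_facts(3))

lemma param_in [simp]: "x \<in> \<phi> ` U \<Longrightarrow> param x \<in> U"
  by (auto simp: chart_facts(3))

lemma coord_param [simp]: "x \<in> \<phi> ` U \<Longrightarrow> \<phi> (param x) = x"
  by auto

lemma param_carrier [simp]: "x \<in> \<phi> ` U \<Longrightarrow> param x \<in> carrier G"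
  using U_carrier param_in by blast

lemma one_coord [simp]: "\<phi> \<one> \<in> \<phi> ` U" "param (\<phi> \<one>) = \<one>"
  using one_U by auto

lemma param_continuous: "continuous_map (top_of_set (\<phi> ` U)) (lie_top G) param"
  using chart_facts(5) by (simp add: param_def)

section \<open>Multiplication in coordinates\<close>

lemma mult_continuous:
  "continuous_map (prod_topology (lie_top G) (lie_top G)) (lie_top G) (\<lambda>(x, y). x \<otimes> y)"
  using mult_smooth by (simp add: smooth_map_def)

lemma left_translation_continuous:
  assumes "g \<in> carrier G"
  shows "continuous_map (lie_top G) (lie_top G) (\<lambda>p. g \<otimes> p)"
proof -
  have "continuous_map (lie_top G) (prod_topology (lie_top G) (lie_top G)) (\<lambda>p. (g, p))"
    using assms by (intro continuous_map_pairedI) (auto simp: topspace)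
  from continuous_map_compose[OF this mult_continuous] show ?thesis by (simp add: o_def)
qed

text \<open>The domain is the preimage of \<open>U\<close> under a continuous map, hence relatively
  open in an open product.\<close>

lemma open_coord_mult_dom: "open coord_mult_dom"
proof -
  let ?D = "top_of_set (\<phi> ` U \<times> \<phi> ` U)"
  have "continuous_map ?D (lie_top G) (\<lambda>z. param (fst z))" "continuous_map ?D (lie_top G) (\<lambda>z. param (snd z))"
    by (auto intro!: continuous_map_compose[OF _ param_continuous, unfolded o_def]
        simp: continuous_map_in_subtopology continuous_on_fst continuous_on_snd)
  then have "continuous_map ?D (prod_topology (lie_top G) (lie_top G)) (\<lambda>z. (param (fst z), param (snd z)))"
    by (rule continuous_map_pairedI)
  from continuous_map_compose[OF this mult_continuous]
  have "continuous_map ?D (lie_top G) (\<lambda>z. param (fst z) \<otimes> param (snd z))" by (simp add: o_def)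
  from openin_continuous_map_preimage[OF this chart_facts(1)]
  have "openin ?D coord_mult_dom" by (simp add: coord_mult_dom_def)
  then show ?thesis using open_Times[OF chart_facts(2) chart_facts(2)] openin_open_eq by blast
qed

lemma coord_mult_dom_one [simp]:
  "x \<in> \<phi> ` U \<Longrightarrow> (x, \<phi> \<one>) \<in> coord_mult_dom" "x \<in> \<phi> ` U \<Longrightarrow> (\<phi> \<one>, x) \<in> coord_mult_dom"
  by (auto simp: coord_mult_dom_def U_carrier)

lemma coord_mult_one [simp]:
  "x \<in> \<phi> ` U \<Longrightarrow> coord_mult (x, \<phi> \<one>) = x" "x \<in> \<phi> ` U \<Longrightarrow> coord_mult (\<phi> \<one>, x) = x"
  by (auto simp: coord_mult_def U_carrier)

lemma param_coord_mult: "z \<in> coord_mult_dom \<Longrightarrow> param (coord_mult z) = param (fst z) \<otimes> param (snd z)"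
  by (simp add: coord_mult_dom_def coord_mult_def)

lemma coord_mult_in: "z \<in> coord_mult_dom \<Longrightarrow> coord_mult z \<in> \<phi> ` U"
  by (simp add: coord_mult_dom_def coord_mult_def)

text \<open>Smoothness of the multiplication is instantiated at the product chart on
  \<open>U \<times> U\<close>; the resulting coordinate expression agrees with
  \<open>coord_mult\<close> on its open domain.\<close>

lemma coord_mult_Ck: "Ck_on n coord_mult_dom coord_mult"
proof -
  let ?m = "\<lambda>(x, y). x \<otimes> y" and ?\<phi>\<phi> = "map_prod \<phi> \<phi>"
  have inj: "inj_on ?\<phi>\<phi> (U \<times> U)" using chart_facts(3) by (intro map_prod_inj_on)
  have inv: "inv_into (U \<times> U) ?\<phi>\<phi> z = (param (fst z), param (snd z))" if "z \<in> coord_mult_dom" for z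
    using that by (intro inv_into_f_eq[OF inj]) (auto simp: coord_mult_dom_def)
  have dom: "?\<phi>\<phi> ` (U \<times> U \<inter> ?m -` U) = coord_mult_dom"
  proof
    show "?\<phi>\<phi> ` (U \<times> U \<inter> ?m -` U) \<subseteq> coord_mult_dom" by (auto simp: coord_mult_dom_def)
    show "coord_mult_dom \<subseteq> ?\<phi>\<phi> ` (U \<times> U \<inter> ?m -` U)"
    proof
      fix z assume "z \<in> coord_mult_dom"
      then have "(param (fst z), param (snd z)) \<in> U \<times> U \<inter> ?m -` U"
        "z = ?\<phi>\<phi> (param (fst z), param (snd z))"
        by (auto simp: coord_mult_dom_def)
      then show "z \<in> ?\<phi>\<phi> ` (U \<times> U \<inter> ?m -` U)" by blast
    qed
  qed
  have "(U \<times> U, ?\<phi>\<phi>) \<in> product_atlas (lie_atlas G) (lie_atlas G)"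
    using chart by (auto simp: product_atlas_def)
  then have "smooth_on (?\<phi>\<phi> ` (U \<times> U \<inter> ?m -` U)) (\<phi> \<circ> ?m \<circ> inv_into (U \<times> U) ?\<phi>\<phi>)"
    using mult_smooth chart unfolding smooth_map_def by fast
  then have "Ck_on n coord_mult_dom (\<phi> \<circ> ?m \<circ> inv_into (U \<times> U) ?\<phi>\<phi>)"
    unfolding dom smooth_on_def by blast
  then show ?thesis
    by (rule Ck_on_cong[OF open_coord_mult_dom, rotated]) (simp add: inv coord_mult_def)
qed

section \<open>Left-invariant vector fields in coordinates\<close>

lemma coord_mult_has_derivative:
  "z \<in> coord_mult_dom \<Longrightarrow> (coord_mult has_derivative frechet_derivative coord_mult (at z)) (at z)"
  using coord_mult_Ck[of "Suc 0"] by (simp flip: frechet_derivative_works)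

text \<open>Since \<open>coord_mult\<close> is twice continuously differentiable, its directional
  derivative is Lipschitz on a ball in the product; \<open>left_field\<close> is the restriction to
  the slice with second coordinate \<open>\<phi> \<one>\<close>.\<close>

lemma left_field_lipschitz:
  obtains r L where "r > 0" "cball (\<phi> \<one>) r \<subseteq> \<phi> ` U" "L-lipschitz_on (cball (\<phi> \<one>) r) (left_field w)"
proof -
  let ?z = "(\<phi> \<one>, \<phi> \<one>)" and ?f = "\<lambda>z. frechet_derivative coord_mult (at z) (0, w)"
  have "Ck_on (Suc 0) coord_mult_dom ?f"
    using coord_mult_Ck[of "Suc (Suc 0)"] by (simp only: Ck_on.simps) blast
  then obtain r L where r: "r > 0" "cball ?z r \<subseteq> coord_mult_dom" and L: "L-lipschitz_on (cball ?z r) ?f"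
    using Ck_on_1_imp_lipschitz[OF _ open_coord_mult_dom, of ?f ?z] by auto
  have in_ball: "(x, \<phi> \<one>) \<in> cball ?z r" if "x \<in> cball (\<phi> \<one>) r" for x
    using that by (simp add: dist_Pair_Pair)
  show thesis
  proof
    show "r > 0" by fact
    show "cball (\<phi> \<one>) r \<subseteq> \<phi> ` U"
    proof
      fix x assume "x \<in> cball (\<phi> \<one>) r"
      then have "(x, \<phi> \<one>) \<in> coord_mult_dom" using in_ball r(2) by blast
      then show "x \<in> \<phi> ` U" by (simp add: coord_mult_dom_def)
    qed
    show "L-lipschitz_on (cball (\<phi> \<one>) r) (left_field w)"
    proof (rule lipschitz_onI)
      fix x y assume "x \<in> cball (\<phi> \<one>) r" "y \<in> cball (\<phi> \<one>) r"
      from lipschitz_onD[OF L in_ball[OF this(1)] in_ball[OF this(2)]]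
      show "dist (left_field w x) (left_field w y) \<le> L * dist x y"
        by (simp add: left_field_def dist_Pair_Pair)
    qed (rule lipschitz_on_nonneg[OF L])
  qed
qed

lemma coord_mult_right_derivative:
  assumes "(x, a t) \<in> coord_mult_dom" "(a has_vector_derivative v) (at t)"
  shows "((\<lambda>s. coord_mult (x, a s)) has_vector_derivative
    frechet_derivative coord_mult (at (x, a t)) (0, v)) (at t)"
  by (rule has_vector_derivative_compose_has_derivative[OF
        has_vector_derivative_Pair[OF has_vector_derivative_const assms(2)]
        coord_mult_has_derivative[OF assms(1)]])

text \<open>This interprets \<open>left_field w\<close>: it is the velocity produced by right
  multiplication with any curve passing through the identity with velocity \<open>w\<close>.\<close>

lemma left_field_derivative:
  assumes "x \<in> \<phi> ` U" "(a has_vector_derivative w) (at t)" "a t = \<phi> \<one>"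
  shows "((\<lambda>s. coord_mult (x, a s)) has_vector_derivative left_field w x) (at t)"
  using coord_mult_right_derivative[of x a t w] assms by (simp add: left_field_def)

text \<open>Multiplying a straight line through \<open>\<phi> \<one>\<close> by the identity returns
  the line itself, so the two computations of its velocity agree.\<close>

lemma left_field_one: "left_field w (\<phi> \<one>) = w"
proof -
  let ?a = "\<lambda>h. \<phi> \<one> + h *\<^sub>R w"
  have a: "(?a has_vector_derivative w) (at 0)" by (auto intro!: derivative_eq_intros)
  have o: "open (?a -` (\<phi> ` U))"
    using chart_facts(2) by (intro open_vimage) (auto intro!: continuous_intros)
  have "(?a has_vector_derivative left_field w (\<phi> \<one>)) (at 0)"
    by (rule has_vector_derivative_transform_within_open[OF left_field_derivative[OF _ a] o]) auto
  then show ?thesis using a vector_derivative_unique_at by blast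
qed

text \<open>Differentiate \<open>\<lambda>h. x y exp (h w)\<close>, associated in the two possible ways, at \<open>h = 0\<close>.\<close>

lemma left_field_invariant:
  assumes xy: "(x, y) \<in> coord_mult_dom"
  shows "frechet_derivative coord_mult (at (x, y)) (0, left_field w y) = left_field w (coord_mult (x, y))"
proof -
  have x: "x \<in> \<phi> ` U" and y: "y \<in> \<phi> ` U" using xy by (auto simp: coord_mult_dom_def)
  let ?a = "\<lambda>h. \<phi> \<one> + h *\<^sub>R w"
  have a: "(?a has_vector_derivative w) (at 0)" by (auto intro!: derivative_eq_intros)
  have "((\<lambda>h. coord_mult (y, ?a h)) has_vector_derivative left_field w y) (at 0)"
    using left_field_derivative[OF y a] by simp
  from coord_mult_right_derivative[of x "\<lambda>h. coord_mult (y, ?a h)", OF _ this]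
  have D: "((\<lambda>h. coord_mult (x, coord_mult (y, ?a h))) has_vector_derivative
      frechet_derivative coord_mult (at (x, y)) (0, left_field w y)) (at 0)"
    using xy y by simp
  \<comment> \<open>Only the product of \<open>y\<close> and \<open>?a h\<close> has to stay in the
    chart: both outer products are then \<open>\<phi>\<close> of the same group element.\<close>
  define S where "S = (\<lambda>h. (y, ?a h)) -` coord_mult_dom"
  have S: "open S" unfolding S_def
    using open_coord_mult_dom by (intro open_vimage) (auto intro!: continuous_intros)
  have assoc: "coord_mult (x, coord_mult (y, ?a h)) = coord_mult (coord_mult (x, y), ?a h)" if "h \<in> S" for h
    using that x y param_coord_mult[of "(y, ?a h)"] param_coord_mult[OF xy]
    by (simp add: S_def coord_mult_def coord_mult_dom_def m_assoc)
  have "((\<lambda>h. coord_mult (coord_mult (x, y), ?a h)) has_vector_derivative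
      frechet_derivative coord_mult (at (x, y)) (0, left_field w y)) (at 0)"
    by (rule has_vector_derivative_transform_within_open[OF D S]) (use y assoc in \<open>auto simp: S_def\<close>)
  moreover have "((\<lambda>h. coord_mult (coord_mult (x, y), ?a h)) has_vector_derivative
      left_field w (coord_mult (x, y))) (at 0)"
    using left_field_derivative[OF coord_mult_in[OF xy] a] by simp
  ultimately show ?thesis by (rule vector_derivative_unique_at)
qed

section \<open>Elementary properties of one-parameter subgroups\<close>

lemma one_parameter_subgroup_carrier:
  "one_parameter_subgroup G \<gamma> \<Longrightarrow> \<gamma> t \<in> carrier G"
  unfolding one_parameter_subgroup_def using continuous_map_funspace topspace by fastforce

lemma one_parameter_subgroup_add: "one_parameter_subgroup G \<gamma> \<Longrightarrow> \<gamma> (s + t) = \<gamma> s \<otimes> \<gamma> t"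
  by (simp add: one_parameter_subgroup_def)

lemma one_parameter_subgroup_zero: "one_parameter_subgroup G \<gamma> \<Longrightarrow> \<gamma> 0 = \<one>"
  using additive_hom_zero one_parameter_subgroup_carrier one_parameter_subgroup_add by blast

lemma one_parameter_subgroup_vimage_open:
  "one_parameter_subgroup G \<gamma> \<Longrightarrow> openin (lie_top G) W \<Longrightarrow> open (\<gamma> -` W)"
  unfolding one_parameter_subgroup_def
  using openin_continuous_map_preimage[of euclideanreal "lie_top G" \<gamma> W] by (simp add: vimage_def)

section \<open>Tangent vectors at the identity in coordinates\<close>

lemma smooth_at_one_differentiable:
  assumes "f \<in> smooth_at_one G"
  shows "(f \<circ> param) differentiable (at (\<phi> \<one>))"
proof -
  obtain W where "\<one> \<in> W" "smooth_on (\<phi> ` (U \<inter> W)) (f \<circ> param)"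
    using assms chart unfolding smooth_near_def param_def by fast
  then show ?thesis using smooth_on_differentiable one_U by blast
qed

text \<open>While \<open>c\<close> stays in \<open>U\<close>, the function
  \<open>f \<circ> c\<close> factors through the chart, and the chain rule applies to
  \<open>f \<circ> param\<close> and \<open>\<phi> \<circ> c\<close>.\<close>

lemma smooth_at_one_derivative:
  assumes f: "f \<in> smooth_at_one G" and I: "open I" "0 \<in> I" "\<And>t. t \<in> I \<Longrightarrow> c t \<in> U" and c0: "c 0 = \<one>"
    and w: "((\<phi> \<circ> c) has_vector_derivative w) (at 0)"
  shows "((f \<circ> c) has_real_derivative frechet_derivative (f \<circ> param) (at (\<phi> \<one>)) w) (at 0)"
proof -
  have "((f \<circ> param) has_derivative frechet_derivative (f \<circ> param) (at (\<phi> \<one>))) (at ((\<phi> \<circ> c) 0))"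
    using smooth_at_one_differentiable[OF f] c0 by (simp add: frechet_derivative_works)
  from has_vector_derivative_compose_has_derivative[OF w this]
  show ?thesis unfolding has_real_derivative_iff_has_vector_derivative
    by (rule has_vector_derivative_transform_within_open[OF _ I(1,2)]) (use I(3) in auto)
qed

text \<open>The vector \<open>w\<close> is the coordinate velocity of a curve representing
  \<open>X\<close>; it is independent of the test function.\<close>

lemma tangent_vector_coordinates:
  assumes "X \<in> tangent_at_one G"
  obtains w where "\<And>f. f \<in> smooth_at_one G \<Longrightarrow> X f = frechet_derivative (f \<circ> param) (at (\<phi> \<one>)) w"
proof -
  obtain c \<epsilon> where X: "X = velocity (lie_top G) (lie_atlas G) c" and \<epsilon>: "\<epsilon> > 0" and c0: "c 0 = \<one>"
    and c: "smooth_map (top_of_set {-\<epsilon><..<\<epsilon>}) {({-\<epsilon><..<\<epsilon>}, id)} (lie_top G) (lie_atlas G) c"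
    using assms unfolding tangent_space_def by blast
  let ?J = "{-\<epsilon><..<\<epsilon>}"
  define I where "I = ?J \<inter> c -` U"
  have "continuous_map (top_of_set ?J) (lie_top G) c" using c by (simp add: smooth_map_def)
  from openin_continuous_map_preimage[OF this chart_facts(1)]
  have "openin (top_of_set ?J) I" by (simp add: I_def vimage_def Int_def)
  then have I: "open I" by (simp add: openin_open_eq)
  have I0: "0 \<in> I" using \<epsilon> c0 one_U by (simp add: I_def)
  have "smooth_on (id ` I) (\<phi> \<circ> c \<circ> inv_into ?J id)"
    using c chart unfolding smooth_map_def I_def by fast
  then have "(\<phi> \<circ> c \<circ> inv_into ?J id) differentiable (at 0)"
    using smooth_on_differentiable I0 by (metis image_id id_apply)
  then obtain w where "((\<phi> \<circ> c \<circ> inv_into ?J id) has_vector_derivative w) (at 0)"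
    by (auto simp: vector_derivative_works)
  \<comment> \<open>The inverse chart \<open>inv_into ?J id\<close> of the interval is the identity
    near 0.\<close>
  then have w: "((\<phi> \<circ> c) has_vector_derivative w) (at 0)"
    by (rule has_vector_derivative_transform_within_open[OF _ I I0])
      (auto simp: I_def inv_into_f_eq[OF inj_on_id])
  show thesis
  proof
    fix f assume f: "f \<in> smooth_at_one G"
    have "((f \<circ> c) has_real_derivative frechet_derivative (f \<circ> param) (at (\<phi> \<one>)) w) (at 0)"
      by (rule smooth_at_one_derivative[OF f I I0 _ c0 w]) (simp add: I_def)
    then show "X f = frechet_derivative (f \<circ> param) (at (\<phi> \<one>)) w"
      using f c0 by (simp add: X velocity_def DERIV_imp_deriv)
  qed
qed

text \<open>Testing with the coordinate functions recovers \<open>w\<close> component by component,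
  including the differentiability of \<open>\<phi> \<circ> \<gamma>\<close> at 0.\<close>

lemma coordinate_velocity:
  assumes X: "\<And>f. f \<in> smooth_at_one G \<Longrightarrow> X f = frechet_derivative (f \<circ> param) (at (\<phi> \<one>)) w"
    and \<gamma>: "\<And>f. f \<in> smooth_at_one G \<Longrightarrow> ((f \<circ> \<gamma>) has_real_derivative X f) (at 0)"
  shows "((\<phi> \<circ> \<gamma>) has_vector_derivative w) (at 0)"
proof -
  have "((\<lambda>t. (\<phi> \<circ> \<gamma>) t \<bullet> b) has_derivative (\<lambda>h. (h *\<^sub>R w) \<bullet> b)) (at 0)" for b
  proof -
    let ?f = "\<lambda>q. \<phi> q \<bullet> b"
    have f: "?f \<in> smooth_at_one G" by (rule smooth_near_coordinate[OF manifold chart one_U])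
    have "((?f \<circ> param) has_derivative (\<lambda>v. v \<bullet> b)) (at (\<phi> \<one>))"
      by (rule has_derivative_transform_within_open[OF _ chart_facts(2)])
        (auto intro!: derivative_eq_intros)
    then have "X ?f = w \<bullet> b" using X[OF f] frechet_derivative_at by metis
    then show ?thesis
      using \<gamma>[OF f] by (simp add: has_field_derivative_def o_def mult.commute[of _ "w \<bullet> b"])
  qed
  then show ?thesis unfolding has_vector_derivative_def by (subst has_derivative_componentwise_within) simp
qed

text \<open>Near \<open>t\<close>, the point \<open>\<gamma> s\<close> is \<open>\<gamma> t\<close>
  times \<open>\<gamma> (s - t)\<close>, and the second factor leaves the identity with velocity
  \<open>w\<close>. Differentiability at 0 thus spreads to all times spent in the chart.\<close>

lemma one_parameter_subgroup_ode:
  assumes \<gamma>: "one_parameter_subgroup G \<gamma>" and w: "((\<phi> \<circ> \<gamma>) has_vector_derivative w) (at 0)"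
    and t: "\<gamma> t \<in> U"
  shows "((\<phi> \<circ> \<gamma>) has_vector_derivative left_field w ((\<phi> \<circ> \<gamma>) t)) (at t)"
proof -
  define S where "S = (\<lambda>s. s - t) -` (\<gamma> -` U) \<inter> \<gamma> -` U"
  have S: "open S" "t \<in> S"
    using one_parameter_subgroup_vimage_open[OF \<gamma> chart_facts(1)] one_parameter_subgroup_zero[OF \<gamma>] one_U t
    by (auto simp: S_def intro!: open_Int open_vimage continuous_intros)
  have "((\<lambda>s. s - t) has_vector_derivative 1) (at t)" by (auto intro!: derivative_eq_intros)
  from vector_diff_chain_at[OF this, of "\<phi> \<circ> \<gamma>" w] w
  have "((\<lambda>s. \<phi> (\<gamma> (s - t))) has_vector_derivative w) (at t)" by (simp add: o_def)
  then have "((\<lambda>s. coord_mult (\<phi> (\<gamma> t), \<phi> (\<gamma> (s - t)))) has_vector_derivative left_field w (\<phi> (\<gamma> t))) (at t)"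
    using t one_parameter_subgroup_zero[OF \<gamma>] by (intro left_field_derivative) auto
  moreover have "coord_mult (\<phi> (\<gamma> t), \<phi> (\<gamma> (s - t))) = (\<phi> \<circ> \<gamma>) s" if "s \<in> S" for s
    using that t one_parameter_subgroup_add[OF \<gamma>, of t "s - t"] by (simp add: S_def coord_mult_def)
  ultimately have "((\<phi> \<circ> \<gamma>) has_vector_derivative left_field w (\<phi> (\<gamma> t))) (at t)"
    by (rule has_vector_derivative_transform_within_open[OF _ S])
  then show ?thesis by simp
qed

lemma one_parameter_subgroup_near_one:
  assumes \<gamma>: "one_parameter_subgroup G \<gamma>" and r: "r > 0"
  obtains \<delta> where "\<delta> > 0" "\<And>t. \<bar>t\<bar> < \<delta> \<Longrightarrow> \<gamma> t \<in> U \<and> \<phi> (\<gamma> t) \<in> cball (\<phi> \<one>) r"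
proof -
  have "openin (subtopology (lie_top G) U) {u \<in> topspace (subtopology (lie_top G) U). \<phi> u \<in> ball (\<phi> \<one>) r}"
    by (rule openin_continuous_map_preimage[OF chart_facts(4)]) simp
  moreover have U: "topspace (subtopology (lie_top G) U) = U" using U_carrier topspace by auto
  \<comment> \<open>Openness relative to \<open>U\<close> is openness in the group because
    \<open>U\<close> is itself open.\<close>
  ultimately have "openin (lie_top G) {u \<in> U. \<phi> u \<in> ball (\<phi> \<one>) r}"
    unfolding U using openin_trans_full[OF _ chart_facts(1)] by blast
  from one_parameter_subgroup_vimage_open[OF \<gamma> this]
  obtain \<delta> where "\<delta> > 0" "ball 0 \<delta> \<subseteq> \<gamma> -` {u \<in> U. \<phi> u \<in> ball (\<phi> \<one>) r}"
    using one_parameter_subgroup_zero[OF \<gamma>] one_U r by (auto elim!: openE[of _ 0])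
  then have "\<gamma> t \<in> U \<and> \<phi> (\<gamma> t) \<in> cball (\<phi> \<one>) r" if "\<bar>t\<bar> < \<delta>" for t
    using that by (auto simp: subset_iff)
  with \<open>\<delta> > 0\<close> show thesis using that by blast
qed

text \<open>Near 0 both are integral curves of one Lipschitz field, hence equal; their values at
  \<open>t\<close> are powers of their values at \<open>t / n\<close>.\<close>

lemma one_parameter_subgroup_unique:
  assumes \<gamma>: "one_parameter_subgroup G \<gamma>" "((\<phi> \<circ> \<gamma>) has_vector_derivative w) (at 0)"
    and \<gamma>': "one_parameter_subgroup G \<gamma>'" "((\<phi> \<circ> \<gamma>') has_vector_derivative w) (at 0)"
  shows "\<gamma> = \<gamma>'"
proof
  fix t
  obtain r L where r: "r > 0" and L: "L-lipschitz_on (cball (\<phi> \<one>) r) (left_field w)"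
    by (rule left_field_lipschitz)
  obtain d where d: "d > 0" "\<And>t. \<bar>t\<bar> < d \<Longrightarrow> \<gamma> t \<in> U \<and> \<phi> (\<gamma> t) \<in> cball (\<phi> \<one>) r"
    using one_parameter_subgroup_near_one[OF \<gamma>(1) r] by blast
  obtain d' where d': "d' > 0" "\<And>t. \<bar>t\<bar> < d' \<Longrightarrow> \<gamma>' t \<in> U \<and> \<phi> (\<gamma>' t) \<in> cball (\<phi> \<one>) r"
    using one_parameter_subgroup_near_one[OF \<gamma>'(1) r] by blast
  have "(\<phi> \<circ> \<gamma>) s = (\<phi> \<circ> \<gamma>') s" if "\<bar>s\<bar> < min d d'" for s
  proof (rule lipschitz_ode_unique[OF L _ _ _ that])
    show "(\<phi> \<circ> \<gamma>) 0 = (\<phi> \<circ> \<gamma>') 0"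
      using one_parameter_subgroup_zero[OF \<gamma>(1)] one_parameter_subgroup_zero[OF \<gamma>'(1)] by simp
    fix t assume t: "\<bar>t\<bar> < min d d'"
    show "(\<phi> \<circ> \<gamma>) t \<in> cball (\<phi> \<one>) r \<and> ((\<phi> \<circ> \<gamma>) has_vector_derivative left_field w ((\<phi> \<circ> \<gamma>) t)) (at t)"
      using d(2)[of t] t one_parameter_subgroup_ode[OF \<gamma>] by simp
    show "(\<phi> \<circ> \<gamma>') t \<in> cball (\<phi> \<one>) r \<and> ((\<phi> \<circ> \<gamma>') has_vector_derivative left_field w ((\<phi> \<circ> \<gamma>') t)) (at t)"
      using d'(2)[of t] t one_parameter_subgroup_ode[OF \<gamma>'] by simp
  qed
  then have eq: "\<gamma> s = \<gamma>' s" if "\<bar>s\<bar> < min d d'" for s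
    using that d(2)[of s] d'(2)[of s] inj_onD[OF chart_facts(3)] by simp
  obtain n where n: "real n > \<bar>t\<bar> / min d d'" using reals_Archimedean2 by blast
  moreover have "n > 0" using n d(1) d'(1) by (cases n) (auto simp: divide_less_0_iff not_less)
  ultimately have "\<bar>t / real n\<bar> < min d d'"
    using d(1) d'(1) by (simp add: divide_less_eq mult.commute del: min_less_iff_conj)
  moreover have "t = real n * (t / real n)" using \<open>n > 0\<close> by simp
  \<comment> \<open>These homomorphisms are global, so the local lemma applies with any radius
    exceeding the absolute value of \<open>n * s\<close>.\<close>
  moreover have "\<rho> (real n * s) = \<rho> s [^] n" if "one_parameter_subgroup G \<rho>" for \<rho> s
    by (rule local_hom_nat_pow[where \<delta> = "\<bar>real n * s\<bar> + 1"])
      (use that one_parameter_subgroup_carrier one_parameter_subgroup_add in auto)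
  ultimately show "\<gamma> t = \<gamma>' t" using eq \<gamma>(1) \<gamma>'(1) by metis
qed

text \<open>For a solution \<open>x\<close> with \<open>x 0 = \<one>\<close>, both \<open>t \<mapsto> x s \<cdot> x t\<close> and \<open>t \<mapsto> x (s + t)\<close> are integral
  curves of the left-invariant field through \<open>x s\<close>, so \<open>x\<close> is a local homomorphism.\<close>

lemma local_one_parameter_subgroup:
  obtains \<delta> x where "\<delta> > 0" "x 0 = \<phi> \<one>" "(x has_vector_derivative w) (at 0)"
    "continuous_on {-\<delta><..<\<delta>} x" "x ` {-\<delta><..<\<delta>} \<subseteq> \<phi> ` U"
    "\<And>s t. \<bar>s\<bar> < \<delta> \<Longrightarrow> \<bar>t\<bar> < \<delta> \<Longrightarrow> param (x (s + t)) = param (x s) \<otimes> param (x t)"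
proof -
  obtain r L where r: "r > 0" "cball (\<phi> \<one>) r \<subseteq> \<phi> ` U"
    and L: "L-lipschitz_on (cball (\<phi> \<one>) r) (left_field w)"
    by (rule left_field_lipschitz)
  obtain d x where d: "d > 0" and x0: "x 0 = \<phi> \<one>"
    and x: "\<And>t. \<bar>t\<bar> < d \<Longrightarrow> x t \<in> ball (\<phi> \<one>) r"
    and x': "\<And>t. \<bar>t\<bar> < d \<Longrightarrow> (x has_vector_derivative left_field w (x t)) (at t)"
    using lipschitz_ode_local[OF L r(1)] by blast
  have xU: "x t \<in> \<phi> ` U" if "\<bar>t\<bar> < d" for t
    using x[OF that] r(2) ball_subset_cball by blast
  \<comment> \<open>Pairs whose product stays in the ball on which the field is Lipschitz, as the
    uniqueness lemma requires.\<close>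
  define N where "N = coord_mult_dom \<inter> coord_mult -` ball (\<phi> \<one>) r"
  have "open N" unfolding N_def
    using coord_mult_Ck[of 0] open_coord_mult_dom by (intro continuous_open_preimage) auto
  moreover have "(\<phi> \<one>, \<phi> \<one>) \<in> N" using r by (simp add: N_def)
  ultimately obtain A B where AB: "open A" "open B" "\<phi> \<one> \<in> A" "\<phi> \<one> \<in> B" "A \<times> B \<subseteq> N"
    by (auto elim: open_prod_elim)
  have x_cont: "continuous_on {-d<..<d} x"
    using x' has_vector_derivative_continuous
    by (intro continuous_at_imp_continuous_on) (fastforce simp: abs_less_iff)
  have "open ({-d<..<d} \<inter> x -` (A \<inter> B))"
    using AB by (intro continuous_open_preimage[OF x_cont]) auto
  then obtain e where "e > 0" "ball 0 e \<subseteq> {-d<..<d} \<inter> x -` (A \<inter> B)"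
    using AB x0 d by (auto elim!: openE[of _ 0])
  then have e: "e > 0" "\<And>t. \<bar>t\<bar> < e \<Longrightarrow> x t \<in> A \<inter> B"
    by (auto simp: subset_iff)
  \<comment> \<open>The bound \<open>e\<close> puts pairs of values of \<open>x\<close> into
    \<open>N\<close>; the bound \<open>d / 2\<close> keeps \<open>s + t\<close> in the interval of
    existence.\<close>
  define \<delta> where "\<delta> = min e (d / 2)"
  have \<delta>: "\<delta> > 0" "\<delta> \<le> e" "\<delta> \<le> d / 2" using d e by (auto simp: \<delta>_def)
  have N: "(x s, x t) \<in> N" if "\<bar>s\<bar> < \<delta>" "\<bar>t\<bar> < \<delta>" for s t
    using that e(2)[of s] e(2)[of t] AB(5) \<delta> by auto
  show thesis
  proof
    show "\<delta> > 0" "x 0 = \<phi> \<one>" by fact+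
    show "(x has_vector_derivative w) (at 0)" using x'[of 0] d x0 left_field_one by simp
    show "continuous_on {-\<delta><..<\<delta>} x" using \<delta> d by (intro continuous_on_subset[OF x_cont]) auto
    show "x ` {-\<delta><..<\<delta>} \<subseteq> \<phi> ` U" using xU \<delta> d by auto
    fix s t :: real assume s: "\<bar>s\<bar> < \<delta>" and t: "\<bar>t\<bar> < \<delta>"
    have "x (s + t) = coord_mult (x s, x t)"
    proof (rule lipschitz_ode_unique[OF L, where x = "\<lambda>t. x (s + t)" and \<delta> = \<delta>])
      show "x (s + 0) = coord_mult (x s, x 0)" using xU[of s] s \<delta> d x0 by simp
      show "\<bar>t\<bar> < \<delta>" by fact
    next
      fix t :: real assume t: "\<bar>t\<bar> < \<delta>"
      have st: "\<bar>s + t\<bar> < d" using s t \<delta> by linarith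
      have "((\<lambda>t. s + t) has_vector_derivative 1) (at t)" by (auto intro!: derivative_eq_intros)
      from vector_diff_chain_at[OF this x'[OF st]]
      show "x (s + t) \<in> cball (\<phi> \<one>) r \<and>
          ((\<lambda>t. x (s + t)) has_vector_derivative left_field w (x (s + t))) (at t)"
        using x[OF st] by (simp add: o_def)
      have dom: "(x s, x t) \<in> coord_mult_dom" "coord_mult (x s, x t) \<in> ball (\<phi> \<one>) r"
        using N[OF s t] by (auto simp: N_def)
      have "(x has_vector_derivative left_field w (x t)) (at t)" using x' t \<delta> d by simp
      from coord_mult_right_derivative[of "x s" x, OF dom(1) this]
      show "coord_mult (x s, x t) \<in> cball (\<phi> \<one>) r \<and>
          ((\<lambda>t. coord_mult (x s, x t)) has_vector_derivative left_field w (coord_mult (x s, x t))) (at t)"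
        using dom left_field_invariant[OF dom(1)] by simp
    qed
    then show "param (x (s + t)) = param (x s) \<otimes> param (x t)"
      using param_coord_mult N[OF s t] by (simp add: N_def)
  qed
qed

text \<open>The algebraic extension gives no continuity away from 0. Continuity is obtained by
  pasting the left translates \<open>\<gamma> t\<^sub>0 \<otimes> \<gamma> (t - t\<^sub>0)\<close>,
  each continuous around \<open>t\<^sub>0\<close>.\<close>

lemma one_parameter_subgroup_exists:
  obtains \<gamma> where "one_parameter_subgroup G \<gamma>" "((\<phi> \<circ> \<gamma>) has_vector_derivative w) (at 0)"
proof -
  obtain \<delta> x where \<delta>: "\<delta> > 0" and x0: "x 0 = \<phi> \<one>" and w: "(x has_vector_derivative w) (at 0)"
    and cont: "continuous_on {-\<delta><..<\<delta>} x" and xU: "x ` {-\<delta><..<\<delta>} \<subseteq> \<phi> ` U"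
    and hom: "\<And>s t. \<bar>s\<bar> < \<delta> \<Longrightarrow> \<bar>t\<bar> < \<delta> \<Longrightarrow> param (x (s + t)) = param (x s) \<otimes> param (x t)"
    by (rule local_one_parameter_subgroup) blast
  let ?I = "{-\<delta><..<\<delta>}"
  have xU': "x t \<in> \<phi> ` U" if "\<bar>t\<bar> < \<delta>" for t using xU that by (auto simp: image_subset_iff abs_less_iff)
  obtain \<gamma> where carrier: "\<And>t. \<gamma> t \<in> carrier G" and \<gamma>: "\<And>s t. \<gamma> (s + t) = \<gamma> s \<otimes> \<gamma> t"
    and \<gamma>x: "\<And>t. \<bar>t\<bar> < \<delta> \<Longrightarrow> \<gamma> t = param (x t)"
    using local_hom_extends[of \<delta> "\<lambda>t. param (x t)"] \<delta> hom xU' param_carrier by blast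
  have "continuous_map (top_of_set ?I) (top_of_set (\<phi> ` U)) x"
    using cont xU by (auto simp: continuous_map_in_subtopology)
  from continuous_map_compose[OF this param_continuous]
  have \<gamma>_I: "continuous_map (top_of_set ?I) (lie_top G) \<gamma>"
    by (rule continuous_map_eq) (auto simp: \<gamma>x abs_less_iff)
  have "continuous_map euclideanreal (lie_top G) \<gamma>"
  proof (rule pasting_lemma[where I = UNIV and T = "\<lambda>t\<^sub>0. (\<lambda>t. t - t\<^sub>0) -` ?I"
        and f = "\<lambda>t\<^sub>0 t. \<gamma> t\<^sub>0 \<otimes> \<gamma> (t - t\<^sub>0)"])
    fix t\<^sub>0 :: real
    show "openin euclideanreal ((\<lambda>t. t - t\<^sub>0) -` ?I)"
      by (auto intro!: open_vimage continuous_intros)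
    have "continuous_map (top_of_set ((\<lambda>t. t - t\<^sub>0) -` ?I)) (top_of_set ?I) (\<lambda>t. t - t\<^sub>0)"
      by (auto simp: continuous_map_in_subtopology intro!: continuous_intros)
    from continuous_map_compose[OF continuous_map_compose[OF this \<gamma>_I] left_translation_continuous[OF carrier]]
    show "continuous_map (top_of_set ((\<lambda>t. t - t\<^sub>0) -` ?I)) (lie_top G) (\<lambda>t. \<gamma> t\<^sub>0 \<otimes> \<gamma> (t - t\<^sub>0))"
      by (simp add: o_def)
  next
    fix t :: real
    show "\<exists>j. j \<in> UNIV \<and> t \<in> (\<lambda>t. t - j) -` ?I \<and> \<gamma> t = \<gamma> j \<otimes> \<gamma> (t - j)"
      using \<delta> \<gamma>[of t 0] by (intro exI[of _ t]) auto
  qed (simp flip: \<gamma>)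
  with \<gamma> have "one_parameter_subgroup G \<gamma>" by (simp add: one_parameter_subgroup_def)
  moreover have "((\<phi> \<circ> \<gamma>) has_vector_derivative w) (at 0)"
    by (rule has_vector_derivative_transform_within_open[OF w, of ?I])
      (use \<delta> xU' in \<open>auto simp: \<gamma>x abs_less_iff\<close>)
  ultimately show thesis by (rule that)
qed

end

section \<open>The exponential map as a well-defined object\<close>

lemma one_parameter_subgroup_velocity_ex1:
  assumes lie: "lie_group G" and X: "X \<in> tangent_at_one G"
  shows "\<exists>!\<gamma>. one_parameter_subgroup G \<gamma> \<and>
    (\<forall>f\<in>smooth_at_one G. ((f \<circ> \<gamma>) has_real_derivative X f) (at 0))"
proof -
  interpret G: group G using lie by (simp add: lie_group_def)
  have "\<one>\<^bsub>G\<^esub> \<in> (\<Union>(U, \<phi>)\<in>lie_atlas G. U)"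
    using lie unfolding lie_group_def smooth_manifold_def by (metis G.one_closed)
  then obtain U \<phi> where "(U, \<phi>) \<in> lie_atlas G" "\<one>\<^bsub>G\<^esub> \<in> U" by blast
  then interpret lie_group_chart G U \<phi> using lie by unfold_locales
  obtain w where w: "\<And>f. f \<in> smooth_at_one G \<Longrightarrow> X f = frechet_derivative (f \<circ> param) (at (\<phi> \<one>\<^bsub>G\<^esub>)) w"
    using tangent_vector_coordinates[OF X] by blast
  \<comment> \<open>The condition on all test functions is equivalent to a single vector equation in
    the chart, to which the existence and uniqueness results apply.\<close>
  have coord: "(\<forall>f\<in>smooth_at_one G. ((f \<circ> \<gamma>) has_real_derivative X f) (at 0)) \<longleftrightarrow>
      ((\<phi> \<circ> \<gamma>) has_vector_derivative w) (at 0)" if \<gamma>: "one_parameter_subgroup G \<gamma>" for \<gamma>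
  proof
    assume "\<forall>f\<in>smooth_at_one G. ((f \<circ> \<gamma>) has_real_derivative X f) (at 0)"
    then show "((\<phi> \<circ> \<gamma>) has_vector_derivative w) (at 0)" using coordinate_velocity[OF w] by blast
  next
    assume v: "((\<phi> \<circ> \<gamma>) has_vector_derivative w) (at 0)"
    have "((f \<circ> \<gamma>) has_real_derivative frechet_derivative (f \<circ> param) (at (\<phi> \<one>\<^bsub>G\<^esub>)) w) (at 0)"
      if "f \<in> smooth_at_one G" for f
      by (rule smooth_at_one_derivative[OF that one_parameter_subgroup_vimage_open[OF \<gamma> chart_facts(1)] _ _ _ v])
        (use one_parameter_subgroup_zero[OF \<gamma>] one_U in auto)
    then show "\<forall>f\<in>smooth_at_one G. ((f \<circ> \<gamma>) has_real_derivative X f) (at 0)" using w by simp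
  qed
  obtain \<gamma> where \<gamma>: "one_parameter_subgroup G \<gamma>" "((\<phi> \<circ> \<gamma>) has_vector_derivative w) (at 0)"
    by (rule one_parameter_subgroup_exists)
  show ?thesis
  proof (rule ex1I)
    show "one_parameter_subgroup G \<gamma> \<and> (\<forall>f\<in>smooth_at_one G. ((f \<circ> \<gamma>) has_real_derivative X f) (at 0))"
      using \<gamma> coord by blast
    show "\<gamma>' = \<gamma>" if "one_parameter_subgroup G \<gamma>' \<and>
        (\<forall>f\<in>smooth_at_one G. ((f \<circ> \<gamma>') has_real_derivative X f) (at 0))" for \<gamma>'
      using one_parameter_subgroup_unique[OF _ _ \<gamma>] coord that by blast
  qed
qed

text \<open>Uniqueness of the one-parameter subgroup makes its value at 1 unique, which resolves the
  definite description.\<close>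

lemma lie_exp_eqI:
  assumes "lie_group G" "X \<in> tangent_at_one G" "one_parameter_subgroup G \<gamma>"
    "\<And>f. f \<in> smooth_at_one G \<Longrightarrow> ((f \<circ> \<gamma>) has_real_derivative X f) (at 0)"
  shows "lie_exp G X = \<gamma> 1"
proof -
  have "one_parameter_subgroup G \<gamma> \<and> (\<forall>f\<in>smooth_at_one G. ((f \<circ> \<gamma>) has_real_derivative X f) (at 0))"
    using assms by blast
  with one_parameter_subgroup_velocity_ex1[OF assms(1,2)] show ?thesis
    unfolding lie_exp_def by (intro the_equality) blast+
qed

text \<open>If \<open>\<gamma>\<close> has velocity \<open>\<iota> m\<close>, then running it at
  speed \<open>a\<close> gives the one-parameter subgroup with velocity
  \<open>\<iota> (a *\<^sub>R m)\<close>, whose value at 1 is \<open>\<gamma> a\<close>.\<close>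

lemma lie_exp_scaleR:
  assumes G: "has_lie_algebra G br \<iota>"
  obtains \<gamma> where "one_parameter_subgroup G \<gamma>" "\<And>a. lie_exp G (\<iota> (a *\<^sub>R m)) = \<gamma> a"
proof -
  have lie: "lie_group G" and tangent: "\<And>x. \<iota> x \<in> tangent_at_one G"
    and scale: "\<And>a x f. \<iota> (a *\<^sub>R x) f = a * \<iota> x f"
    using G by (auto simp: has_lie_algebra_def bij_betw_def)
  obtain \<gamma> where \<gamma>: "one_parameter_subgroup G \<gamma>"
    and v: "\<And>f. f \<in> smooth_at_one G \<Longrightarrow> ((f \<circ> \<gamma>) has_real_derivative \<iota> m f) (at 0)"
    using one_parameter_subgroup_velocity_ex1[OF lie tangent] by blast
  have "lie_exp G (\<iota> (a *\<^sub>R m)) = \<gamma> a" for a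
  proof -
    have "one_parameter_subgroup G (\<lambda>t. \<gamma> (a * t))"
      using \<gamma> continuous_map_compose[of euclideanreal euclideanreal "\<lambda>t. a * t" "lie_top G" \<gamma>]
      by (auto simp: one_parameter_subgroup_def distrib_left o_def intro!: continuous_intros)
    moreover have "((f \<circ> (\<lambda>t. \<gamma> (a * t))) has_real_derivative \<iota> (a *\<^sub>R m) f) (at 0)"
      if "f \<in> smooth_at_one G" for f
    proof -
      have "((\<lambda>t. a * t) has_real_derivative a) (at 0)" by (auto intro!: derivative_eq_intros)
      moreover have "((f \<circ> \<gamma>) has_real_derivative \<iota> m f) (at (a * 0))" using v[OF that] by simp
      ultimately have "((f \<circ> \<gamma> \<circ> (\<lambda>t. a * t)) has_real_derivative \<iota> m f * a) (at 0)" by (rule DERIV_chain[rotated])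
      then show ?thesis unfolding scale by (simp add: o_def mult.commute[of a])
    qed
    ultimately show ?thesis using lie_exp_eqI[OF lie tangent] by fastforce
  qed
  with \<gamma> show thesis using that by blast
qed

section \<open>The identity for the exponential of \<open>2 m\<close>\<close>

theorem proposition8:
  fixes G :: "('a, 'e::euclidean_space) smooth_group"
    and K :: "('a, 'f::euclidean_space) smooth_group"
    and br :: "'l::euclidean_space \<Rightarrow> 'l \<Rightarrow> 'l"
    and \<theta> :: "'l \<Rightarrow> 'l"
    and \<iota> :: "'l \<Rightarrow> ('a \<Rightarrow> real) \<Rightarrow> real"
    and \<Theta> :: "'a \<Rightarrow> 'a"
    and g k\<^sub>0 :: 'a
    and m :: 'l
  assumes "semisimple br"
    and "orthogonal_symmetric_lie_algebra br \<theta>"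
    and "symmetric_pair G K br \<theta> \<iota>"
    and "involutive_lie_group_automorphism G \<Theta>"
    and "has_differential_at_one G \<iota> \<Theta> \<theta>"
    and "\<forall>k\<in>carrier K. \<Theta> k = k"
    and "\<forall>m'\<in>minus_eigenspace \<theta>. \<Theta> (lie_exp G (\<iota> m')) = lie_exp G (\<iota> (- m'))"
    and "g \<in> carrier G" and "k\<^sub>0 \<in> carrier K" and "m \<in> minus_eigenspace \<theta>"
    and "g = k\<^sub>0 \<otimes>\<^bsub>G\<^esub> lie_exp G (\<iota> m)"
  shows "lie_exp G (\<iota> (2 *\<^sub>R m)) = \<Theta> (inv\<^bsub>G\<^esub> g) \<otimes>\<^bsub>G\<^esub> g"
proof -
  have G: "has_lie_algebra G br \<iota>" and K: "subgroup (carrier K) G"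
    using assms(3) by (auto simp: symmetric_pair_def lie_subgroup_with_lie_algebra_def lie_subgroup_def)
  then interpret group G by (simp add: has_lie_algebra_def lie_group_def)
  interpret \<Theta>: group_hom G G \<Theta>
    using assms(4) by unfold_locales (simp add: involutive_lie_group_automorphism_def iso_def)
  obtain \<gamma> where \<gamma>: "one_parameter_subgroup G \<gamma>" and exp: "\<And>a. lie_exp G (\<iota> (a *\<^sub>R m)) = \<gamma> a"
    using lie_exp_scaleR[OF G] by blast
  have carrier: "\<gamma> t \<in> carrier G" for t
    using \<gamma> G continuous_map_funspace[of euclideanreal "lie_top G" \<gamma>]
    by (auto simp: one_parameter_subgroup_def has_lie_algebra_def lie_group_def)
  have add: "\<gamma> (s + t) = \<gamma> s \<otimes>\<^bsub>G\<^esub> \<gamma> t" for s t using \<gamma> by (simp add: one_parameter_subgroup_def)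
  have "\<gamma> 0 = \<one>\<^bsub>G\<^esub>" using additive_hom_zero[of \<gamma>] carrier add by blast
  then have inv: "inv\<^bsub>G\<^esub> \<gamma> (- 1) = \<gamma> 1"
    using add[of 1 "-1"] carrier by (intro inv_equality) auto
  have k: "k\<^sub>0 \<in> carrier G" "\<Theta> k\<^sub>0 = k\<^sub>0" using K assms(6,9) subgroup.mem_carrier by auto
  have g: "g = k\<^sub>0 \<otimes>\<^bsub>G\<^esub> \<gamma> 1" using assms(11) exp[of 1] by simp
  have "\<Theta> (\<gamma> 1) = \<gamma> (- 1)" using bspec[OF assms(7,10)] exp[of 1] exp[of "-1"] by simp
  \<comment> \<open>Inversion reverses the factors of \<open>g\<close>, and \<open>\<Theta>\<close>
    fixes \<open>k\<^sub>0\<close> and turns \<open>\<gamma> 1\<close> into its inverse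
    \<open>\<gamma> (- 1)\<close>. The factor \<open>k\<^sub>0\<close> then cancels against
    \<open>g\<close>.\<close>
  then have "\<Theta> (inv\<^bsub>G\<^esub> g) = \<gamma> 1 \<otimes>\<^bsub>G\<^esub> inv\<^bsub>G\<^esub> k\<^sub>0"
    using k carrier by (simp add: g \<Theta>.hom_inv inv_mult_group inv)
  moreover have "inv\<^bsub>G\<^esub> k\<^sub>0 \<otimes>\<^bsub>G\<^esub> g = \<gamma> 1"
    using k carrier by (simp add: g flip: m_assoc)
  ultimately have "\<Theta> (inv\<^bsub>G\<^esub> g) \<otimes>\<^bsub>G\<^esub> g = \<gamma> 1 \<otimes>\<^bsub>G\<^esub> \<gamma> 1"
    using k carrier assms(8) by (simp add: m_assoc)
  then show ?thesis using exp[of 2] add[of 1 1] by simp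
qed

end
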